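(* For a natural number $n$, let $\rho(n)=|\mathcal{X}'_n|/|\mathcal{X}_n|$ be the proportion of Dirichlet characters modulo $n$ that are primitive. For $k\ge 1$ let $n_k$ be the product of the first $k$ primes. Then $$\lim_{k\to\infty}\rho(2n_k)\log\log(2n_k)=C_2\,e^{-\gamma},$$ where $\gamma$ is the Euler--Mascheroni constant and $C_2=\prod_{p>2}\frac{p(p-2)}{(p-1)^2}$ (product over primes $p>2$) is the twin prime constant.
   Context: $\mathcal{X}_n$ is the set of all Dirichlet characters modulo $n$, and $\mathcal{X}'_n\subseteq\mathcal{X}_n$ is the subset of primitive characters (those whose conductor equals $n$). $\gamma=\lim_{n\to\infty}\left(\sum_{m=1}^n \frac1m-\log n\right)$. *)

theory Defs
  imports
    "HOL-Analysis.Analysis"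
    "HOL-Computational_Algebra.Primes"
begin

definition dirichlet_character :: "nat \<Rightarrow> (int \<Rightarrow> complex) \<Rightarrow> bool" where
  "dirichlet_character n \<eta> \<longleftrightarrow>
     (\<forall>a b. \<eta> (a * b) = \<eta> a * \<eta> b) \<and>
     (\<forall>a. \<eta> (a + int n) = \<eta> a) \<and>
     (\<forall>a. \<eta> a \<noteq> 0 \<longleftrightarrow> coprime a (int n))"

definition dirichlet_characters :: "nat \<Rightarrow> (int \<Rightarrow> complex) set" where
  "dirichlet_characters n = {\<eta>. dirichlet_character n \<eta>}"

text \<open>
  For \<open>d\<close> dividing \<open>n\<close>, this says that \<open>\<eta>\<close>, as a character of the unit group modulo \<open>n\<close>,
  factors through the unit group modulo \<open>d\<close>.
\<close>

definition induced_from :: "nat \<Rightarrow> nat \<Rightarrow> (int \<Rightarrow> complex) \<Rightarrow> bool" where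
  "induced_from n d \<eta> \<longleftrightarrow>
     (\<exists>\<psi>. dirichlet_character d \<psi> \<and> (\<forall>a. coprime a (int n) \<longrightarrow> \<eta> a = \<psi> a))"

definition conductor :: "nat \<Rightarrow> (int \<Rightarrow> complex) \<Rightarrow> nat" where
  "conductor n \<eta> = (LEAST d. d > 0 \<and> d dvd n \<and> induced_from n d \<eta>)"

definition primitive_characters :: "nat \<Rightarrow> (int \<Rightarrow> complex) set" where
  "primitive_characters n = {\<eta> \<in> dirichlet_characters n. conductor n \<eta> = n}"

definition primitive_proportion :: "nat \<Rightarrow> real" where
  "primitive_proportion n =
     real (card (primitive_characters n)) / real (card (dirichlet_characters n))"

definition primorial :: "nat \<Rightarrow> nat" where
  "primorial k = (\<Prod>i<k. enumerate {p. prime p} i)"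

text \<open>
  The infinite product converges (to a nonzero value) in the sense of \<open>convergent_prod\<close>:
  each factor with \<open>p > 2\<close> prime equals \<open>1 - 1 / (p - 1)\<^sup>2\<close>.
\<close>

definition twin_prime_constant :: real where
  "twin_prime_constant =
     (\<Prod>p. if prime p \<and> p > 2 then real p * (real p - 2) / (real p - 1)\<^sup>2 else 1)"

end

theory Submission
  imports Defs "HOL-Number_Theory.Residue_Primitive_Roots" "HOL-Real_Asymp.Real_Asymp"
begin

text \<open>
  The proportion of primitive characters is multiplicative over coprime moduli; it is \<open>1/2\<close> at 4 and
  \<open>(p - 2)/(p - 1)\<close> at an odd prime \<open>p\<close>, because there the principal character is the only imprimitive one.
  Since \<open>(p - 2)/(p - 1) = p(p - 2)/(p - 1)\<^sup>2 \<cdot> (1 - 1/p)\<close> and \<open>1/2 = 1 - 1/2\<close>, the proportion at twice a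
  primorial is a partial twin prime product times \<open>\<Prod>p\<le>N. 1 - 1/p\<close>, where \<open>N\<close> is the last prime used.
  The latter is \<open>exp(-\<gamma>) / ln N\<close> asymptotically by Mertens' third theorem, and \<open>ln ln (2 n\<^sub>k)\<close> is asymptotic to
  \<open>ln N\<close> because \<open>\<theta>(N)\<close> has order \<open>N\<close>.

  For Mertens' theorem, comparing \<open>ln N!\<close> with its prime factorisation gives
  \<open>\<Sum>p\<le>N. ln p / p = ln N + O(1)\<close>, and partial summation yields
  \<open>\<Sum>p\<le>N. 1/p = ln ln N + M + o(1)\<close> for some \<open>M\<close>. The value of \<open>M\<close> is found by grouping the primes into
  dyadic blocks: if \<open>a\<^sub>n\<close> is the sum of \<open>1/p\<close> over \<open>2^n < p \<le> 2^(n+1)\<close>, then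
  \<open>\<Sum>n. a\<^sub>n - 1/(n+1)\<close> converges to \<open>M + ln ln 2 - \<gamma>\<close>. Abel's limit theorem evaluates the same
  sum as a limit of power series at \<open>x = 2 powr (-\<sigma>)\<close>, \<open>\<sigma> \<rightarrow> 0\<close>; there \<open>\<Sum>n. a\<^sub>n x^n\<close> is within a
  factor \<open>x\<close> of \<open>\<Sum>p. p powr (-1 - \<sigma>)\<close>, which the Euler product and the simple pole of zeta control.
\<close>

section \<open>Counting Dirichlet characters\<close>

lemma dirichlet_character_mult:
  "dirichlet_character n \<eta> \<Longrightarrow> \<eta> (a * b) = \<eta> a * \<eta> b"
  by (simp add: dirichlet_character_def)

lemma dirichlet_character_eq_0_iff:
  "dirichlet_character n \<eta> \<Longrightarrow> \<eta> a = 0 \<longleftrightarrow> \<not> coprime a (int n)"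
  by (auto simp: dirichlet_character_def)

lemma dirichlet_character_1:
  assumes "dirichlet_character n \<eta>" shows "\<eta> 1 = 1"
  using dirichlet_character_mult[OF assms, of 1 1] dirichlet_character_eq_0_iff[OF assms, of 1]
  by simp

lemma dirichlet_character_power:
  assumes "dirichlet_character n \<eta>" shows "\<eta> (a ^ k) = \<eta> a ^ k"
  by (induction k)
     (simp_all add: dirichlet_character_1[OF assms] dirichlet_character_mult[OF assms])

lemma dirichlet_character_cong:
  assumes \<eta>: "dirichlet_character n \<eta>" and ab: "[a = b] (mod int n)"
  shows "\<eta> a = \<eta> b"
proof -
  have *: "\<eta> (c + int n * int j) = \<eta> c" for c j
  proof (induction j)
    case (Suc j)
    have "\<eta> (c + int n * int (Suc j)) = \<eta> ((c + int n * int j) + int n)"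
      by (simp add: algebra_simps)
    with Suc \<eta> show ?case by (simp add: dirichlet_character_def)
  qed simp
  obtain k where k: "b = a + int n * k"
    using ab by (auto simp: cong_iff_lin)
  show ?thesis
  proof (cases "k \<ge> 0")
    case True
    then show ?thesis using *[of a "nat k"] k by simp
  next
    \<comment> \<open>The induction only shifts upwards, so for a negative multiple of n the roles
      of a and b are exchanged.\<close>
    case False
    then show ?thesis using *[of b "nat (- k)"] k by simp
  qed
qed

definition principal_character :: "nat \<Rightarrow> int \<Rightarrow> complex" where
  "principal_character n a = (if coprime a (int n) then 1 else 0)"

lemma dirichlet_character_principal: "dirichlet_character n (principal_character n)"
  unfolding dirichlet_character_def
proof (intro conjI allI)
  fix a
  have "coprime (a + int n) (int n) \<longleftrightarrow> coprime a (int n)"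
    by (simp add: coprime_iff_gcd_eq_1)
  then show "principal_character n (a + int n) = principal_character n a"
    by (simp add: principal_character_def)
qed (simp_all add: principal_character_def)

text \<open>A primitive root g generates the unit group, so a character is determined by its value
  at g. These values are exactly the roots of unity of order dividing \<open>totient n\<close>, and
  there are \<open>totient n\<close> of them.\<close>

lemma card_dirichlet_characters_primroot:
  assumes "n > 1" and g: "residue_primroot n g"
  shows "card (dirichlet_characters n) = totient n"
proof -
  let ?\<phi> = "totient n"
  have gn: "coprime n g" and ord: "ord n g = ?\<phi>"
    using g by (auto simp: residue_primroot_def)
  have gn': "coprime (int g) (int n)"
    using gn by (simp add: coprime_commute)
  have \<phi>: "?\<phi> > 0" using \<open>n > 1\<close> by simp
  have pow_eq: "[int g ^ k = int g ^ l] (mod int n) \<longleftrightarrow> [k = l] (mod ?\<phi>)" for k l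
  proof -
    have "[int g ^ k = int g ^ l] (mod int n) \<longleftrightarrow> [g ^ k = g ^ l] (mod n)"
      by (metis cong_int_iff of_nat_power)
    then show ?thesis using order_divides_expdiff[OF gn] ord by simp
  qed
  have generates: "\<exists>k. [int g ^ k = a] (mod int n)" if a: "coprime a (int n)" for a
  proof -
    define b where "b = nat (a mod int n)"
    have b: "int b = a mod int n" using \<open>n > 1\<close> by (simp add: b_def)
    have "coprime (int b) (int n)" using a b \<open>n > 1\<close> by simp
    then have cop: "coprime b n" by simp
    moreover have "b \<noteq> 0" using cop \<open>n > 1\<close> by (intro notI) simp
    moreover have "b \<le> n" using b \<open>n > 1\<close>
      by (metis less_imp_le nat_int_comparison(2) of_nat_0_less_iff pos_mod_bound less_trans zero_less_one)
    ultimately have "b \<in> totatives n" by (auto simp: totatives_def)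
    then have "b \<in> (\<lambda>k. g ^ k mod n) ` {..<totient n}"
      using residue_primroot_is_generator[OF \<open>n > 1\<close> g] by (simp add: bij_betw_def)
    then obtain k where "g ^ k mod n = b" by blast
    then have "int g ^ k mod int n = a mod int n"
      using b by (metis of_nat_mod of_nat_power)
    then show ?thesis by (auto simp: cong_def)
  qed
  have "bij_betw (\<lambda>\<eta>. \<eta> (int g)) (dirichlet_characters n) {z. z ^ ?\<phi> = 1}"
    unfolding bij_betw_def
  proof (intro conjI)
    show "inj_on (\<lambda>\<eta>. \<eta> (int g)) (dirichlet_characters n)"
    proof (rule inj_onI, rule ext)
      fix \<eta> \<psi> a
      assume *: "\<eta> \<in> dirichlet_characters n" "\<psi> \<in> dirichlet_characters n" "\<eta> (int g) = \<psi> (int g)"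
      then have d: "dirichlet_character n \<eta>" "dirichlet_character n \<psi>"
        by (auto simp: dirichlet_characters_def)
      show "\<eta> a = \<psi> a"
      proof (cases "coprime a (int n)")
        case True
        then obtain k where k: "[a = int g ^ k] (mod int n)"
          using generates cong_sym by blast
        show ?thesis
          using * dirichlet_character_cong[OF d(1) k] dirichlet_character_cong[OF d(2) k]
          by (simp add: dirichlet_character_power[OF d(1)] dirichlet_character_power[OF d(2)])
      next
        case False
        then show ?thesis
          using dirichlet_character_eq_0_iff[OF d(1), of a] dirichlet_character_eq_0_iff[OF d(2), of a]
          by simp
      qed
    qed
  next
    show "(\<lambda>\<eta>. \<eta> (int g)) ` dirichlet_characters n = {z. z ^ ?\<phi> = 1}"
    proof (intro equalityI subsetI)
      fix z assume "z \<in> (\<lambda>\<eta>. \<eta> (int g)) ` dirichlet_characters n"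
      then obtain \<eta> where \<eta>: "dirichlet_character n \<eta>" and z: "z = \<eta> (int g)"
        by (auto simp: dirichlet_characters_def)
      have "[int g ^ ?\<phi> = int g ^ 0] (mod int n)"
        by (simp only: pow_eq) (simp add: cong_def)
      then have "\<eta> (int g ^ ?\<phi>) = 1"
        using dirichlet_character_cong[OF \<eta>] dirichlet_character_1[OF \<eta>] by fastforce
      then show "z \<in> {z. z ^ ?\<phi> = 1}"
        by (simp add: z dirichlet_character_power[OF \<eta>])
    next
      fix z :: complex assume "z \<in> {z. z ^ ?\<phi> = 1}"
      then have z: "z ^ ?\<phi> = 1" by simp
      have z_pow: "z ^ k = z ^ (k mod ?\<phi>)" for k
      proof -
        have "z ^ k = z ^ (?\<phi> * (k div ?\<phi>) + k mod ?\<phi>)" by simp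
        also have "\<dots> = z ^ (k mod ?\<phi>)"
          by (simp only: power_add power_mult z) simp
        finally show ?thesis .
      qed
      have z0: "z \<noteq> 0" using z \<phi> by (auto simp: power_0_left)
      \<comment> \<open>This raises z to a discrete logarithm of a. The chosen exponent is unique
        only modulo \<open>totient n\<close>, which is harmless because
        \<open>z ^ totient n = 1\<close>.\<close>
      define \<eta> where
        "\<eta> a = (if coprime a (int n) then z ^ (SOME k. [int g ^ k = a] (mod int n)) else 0)" for a
      have \<eta>_eq: "\<eta> a = z ^ k" if k: "[int g ^ k = a] (mod int n)" for a k
      proof -
        define l where "l = (SOME k. [int g ^ k = a] (mod int n))"
        have "[int g ^ l = a] (mod int n)" unfolding l_def by (rule someI) (rule k)
        then have "[int g ^ l = int g ^ k] (mod int n)"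
          using k cong_sym cong_trans by blast
        then have "l mod ?\<phi> = k mod ?\<phi>" by (simp only: pow_eq) (simp add: cong_def)
        then have "z ^ l = z ^ k" using z_pow by metis
        moreover have "coprime a (int n)"
          using cong_imp_coprime[OF k] gn' by simp
        ultimately show ?thesis by (simp add: \<eta>_def l_def)
      qed
      have "dirichlet_character n \<eta>"
        unfolding dirichlet_character_def
      proof (intro conjI allI)
        fix a b
        show "\<eta> (a * b) = \<eta> a * \<eta> b"
        proof (cases "coprime a (int n) \<and> coprime b (int n)")
          case True
          then obtain k l where kl: "[int g ^ k = a] (mod int n)" "[int g ^ l = b] (mod int n)"
            using generates by blast
          then have "[int g ^ (k + l) = a * b] (mod int n)"
            by (simp add: power_add cong_mult)
          from \<eta>_eq[OF this] \<eta>_eq[OF kl(1)] \<eta>_eq[OF kl(2)] show ?thesis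
            by (simp only: power_add)
        qed (auto simp: \<eta>_def)
      next
        fix a
        have "coprime (a + int n) (int n) \<longleftrightarrow> coprime a (int n)"
          by (simp add: coprime_iff_gcd_eq_1)
        then show "\<eta> (a + int n) = \<eta> a"
          by (simp add: \<eta>_def cong_def)
      next
        fix a
        show "(\<eta> a \<noteq> 0) = coprime a (int n)" using z0 by (auto simp: \<eta>_def)
      qed
      moreover have "\<eta> (int g) = z" using \<eta>_eq[of 1 "int g"] by simp
      ultimately show "z \<in> (\<lambda>\<eta>. \<eta> (int g)) ` dirichlet_characters n"
        by (auto simp: dirichlet_characters_def)
    qed
  qed
  then have "card (dirichlet_characters n) = card {z :: complex. z ^ ?\<phi> = 1}"
    by (rule bij_betw_same_card)
  also have "\<dots> = ?\<phi>" by (rule card_roots_unity_eq) (rule \<phi>)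
  finally show ?thesis .
qed

section \<open>Splitting characters along coprime moduli\<close>

lemma dirichlet_character_product:
  assumes "dirichlet_character m \<eta>" "dirichlet_character n \<psi>"
  shows "dirichlet_character (m * n) (\<lambda>a. \<eta> a * \<psi> a)"
proof -
  have "\<eta> (a + int m * int n) = \<eta> a" "\<psi> (a + int m * int n) = \<psi> a" for a
    by (rule dirichlet_character_cong[OF assms(1)], simp add: cong_def)
       (rule dirichlet_character_cong[OF assms(2)], simp add: cong_def)
  then show ?thesis
    using assms by (auto simp: dirichlet_character_def)
qed

lemma exists_cong_and_cong_1:
  assumes "coprime m n"
  shows "\<exists>b :: int. [b = a] (mod int m) \<and> [b = 1] (mod int n)"
  using assms by (intro binary_chinese_remainder_int) simp

text \<open>The map L embeds the residues modulo m into those modulo m n by putting 1 in the other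
  coordinate of the Chinese remainder theorem. It is multiplicative only up to congruence, which
  suffices since \<eta> respects congruence.\<close>

lemma dirichlet_character_component:
  assumes \<eta>: "dirichlet_character (m * n) \<eta>" and cop: "coprime m n"
    and L: "\<And>a. [L a = a] (mod int m)" "\<And>a. [L a = 1] (mod int n)"
  shows "dirichlet_character m (\<lambda>a. \<eta> (L a))"
proof -
  have \<eta>_cong: "\<eta> a = \<eta> b" if "[a = b] (mod int m)" "[a = b] (mod int n)" for a b
    using dirichlet_character_cong[OF \<eta>, of a b] coprime_cong_mult[OF that] cop by simp
  have "[L (a * b) = L a * L b] (mod int m)" "[L (a * b) = L a * L b] (mod int n)" for a b
    using cong_trans[OF L(1)[of "a * b"] cong_sym[OF cong_mult[OF L(1)[of a] L(1)[of b]]]]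
      cong_trans[OF L(2)[of "a * b"]] cong_sym[OF cong_mult[OF L(2)[of a] L(2)[of b]]]
    by simp_all
  then have "\<eta> (L (a * b)) = \<eta> (L a) * \<eta> (L b)" for a b
    using \<eta>_cong dirichlet_character_mult[OF \<eta>] by metis
  moreover have "\<eta> (L (a + int m)) = \<eta> (L a)" for a
  proof (rule \<eta>_cong)
    have "[a + int m = a] (mod int m)" by (simp add: cong_def)
    then show "[L (a + int m) = L a] (mod int m)"
      using L(1) cong_sym cong_trans by meson
    show "[L (a + int m) = L a] (mod int n)"
      using L(2) cong_sym cong_trans by meson
  qed
  moreover have "\<eta> (L a) \<noteq> 0 \<longleftrightarrow> coprime a (int m)" for a
  proof -
    have "coprime (L a) (int m) \<longleftrightarrow> coprime a (int m)"
      using L(1)[of a] cong_imp_coprime cong_sym by blast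
    moreover have "coprime (L a) (int n)"
      using cong_imp_coprime[OF cong_sym[OF L(2)[of a]]] by simp
    ultimately show ?thesis using \<eta> by (auto simp: dirichlet_character_def)
  qed
  ultimately show ?thesis by (simp add: dirichlet_character_def)
qed

text \<open>Modulo m n every a is the product of its lifts (a, 1) and (1, a). Applying \<eta> to
  this product separates the two components.\<close>

lemma dirichlet_character_decompose:
  assumes \<eta>: "dirichlet_character (m * n) \<eta>" and cop: "coprime m n"
  obtains \<eta>1 \<eta>2 where "dirichlet_character m \<eta>1" "dirichlet_character n \<eta>2"
    "\<eta> = (\<lambda>a. \<eta>1 a * \<eta>2 a)"
proof -
  obtain L where L: "\<And>a. [L a = a] (mod int m)" "\<And>a. [L a = 1] (mod int n)"
    using exists_cong_and_cong_1[OF cop] by metis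
  obtain L' where L': "\<And>a. [L' a = a] (mod int n)" "\<And>a. [L' a = 1] (mod int m)"
    using exists_cong_and_cong_1[of n m] cop by (metis coprime_commute)
  have "[L a * L' a = a] (mod int m)" "[L a * L' a = a] (mod int n)" for a
    using cong_mult[OF L(1)[of a] L'(2)[of a]] cong_mult[OF L(2)[of a] L'(1)[of a]] by simp_all
  then have "[L a * L' a = a] (mod int (m * n))" for a
    using coprime_cong_mult[of "L a * L' a" a "int m" "int n" for a] cop by simp
  then have "\<eta> a = \<eta> (L a) * \<eta> (L' a)" for a
    using dirichlet_character_cong[OF \<eta>] dirichlet_character_mult[OF \<eta>] by metis
  moreover have "dirichlet_character m (\<lambda>a. \<eta> (L a))"
    by (rule dirichlet_character_component[OF \<eta> cop L])
  moreover have "dirichlet_character n (\<lambda>a. \<eta> (L' a))"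
    using dirichlet_character_component[of n m \<eta> L'] \<eta> cop L'
    by (simp add: mult.commute coprime_commute)
  ultimately show ?thesis using that by blast
qed

text \<open>Evaluating at a lift that is 1 modulo n makes the second factors disappear. Non-units
  modulo m need no lift, as both characters vanish there.\<close>

lemma dirichlet_character_product_inject:
  assumes "coprime m n" "dirichlet_character m \<eta>" "dirichlet_character n \<psi>"
    "dirichlet_character m \<eta>'" "dirichlet_character n \<psi>'"
    and eq: "\<And>a. coprime a (int (m * n)) \<Longrightarrow> \<eta> a * \<psi> a = \<eta>' a * \<psi>' a"
  shows "\<eta> = \<eta>'"
proof
  fix a
  show "\<eta> a = \<eta>' a"
  proof (cases "coprime a (int m)")
    case True
    obtain b where b: "[b = a] (mod int m)" "[b = 1] (mod int n)"
      using exists_cong_and_cong_1[OF assms(1)] by blast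
    have "coprime b (int m)" "coprime b (int n)"
      using cong_imp_coprime[OF cong_sym[OF b(1)]] cong_imp_coprime[OF cong_sym[OF b(2)]] True
      by auto
    then have "\<eta> b * \<psi> b = \<eta>' b * \<psi>' b" by (intro eq) simp
    then show ?thesis
      using dirichlet_character_cong[OF assms(2) b(1)] dirichlet_character_cong[OF assms(4) b(1)]
        dirichlet_character_cong[OF assms(3) b(2)] dirichlet_character_cong[OF assms(5) b(2)]
        dirichlet_character_1[OF assms(3)] dirichlet_character_1[OF assms(5)]
      by simp
  next
    case False
    then show ?thesis
      using dirichlet_character_eq_0_iff[OF assms(2), of a]
        dirichlet_character_eq_0_iff[OF assms(4), of a] by simp
  qed
qed

section \<open>Primitivity and coprime products\<close>

lemma primitive_characters_iff:
  assumes "n > 0"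
  shows "\<eta> \<in> primitive_characters n \<longleftrightarrow>
    dirichlet_character n \<eta> \<and> (\<forall>d. d dvd n \<longrightarrow> d < n \<longrightarrow> \<not> induced_from n d \<eta>)"
proof (cases "dirichlet_character n \<eta>")
  case True
  then have ind: "0 < n \<and> n dvd n \<and> induced_from n n \<eta>"
    using assms by (auto simp: induced_from_def)
  show ?thesis
  proof
    assume "\<eta> \<in> primitive_characters n"
    then have "(LEAST d. d > 0 \<and> d dvd n \<and> induced_from n d \<eta>) = n"
      by (simp add: primitive_characters_def conductor_def)
    then show "dirichlet_character n \<eta> \<and> (\<forall>d. d dvd n \<longrightarrow> d < n \<longrightarrow> \<not> induced_from n d \<eta>)"
      using True not_less_Least[of _ "\<lambda>d. d > 0 \<and> d dvd n \<and> induced_from n d \<eta>"] assms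
      by (metis dvd_pos_nat)
  next
    assume *: "dirichlet_character n \<eta> \<and> (\<forall>d. d dvd n \<longrightarrow> d < n \<longrightarrow> \<not> induced_from n d \<eta>)"
    have "(LEAST d. d > 0 \<and> d dvd n \<and> induced_from n d \<eta>) = n"
      using ind * by (intro Least_equality) (auto simp: not_less[symmetric])
    then show "\<eta> \<in> primitive_characters n"
      using True by (simp add: primitive_characters_def conductor_def dirichlet_characters_def)
  qed
qed (auto simp: primitive_characters_def dirichlet_characters_def)

text \<open>Split the inducing character along \<open>d1\<close> and \<open>d2\<close>, and compare
  both sides at the lift of a unit modulo m that is 1 modulo n. This lift is also 1 modulo
  \<open>d2\<close>, so the second factors on both sides are 1.\<close>

lemma induced_from_component:
  assumes cop: "coprime m n" and d: "d1 dvd m" "d2 dvd n"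
    and \<eta>: "dirichlet_character m \<eta>1" "dirichlet_character n \<eta>2"
    and ind: "induced_from (m * n) (d1 * d2) (\<lambda>a. \<eta>1 a * \<eta>2 a)"
  shows "induced_from m d1 \<eta>1"
proof -
  have "coprime d1 d2" using cop d by (meson coprime_divisors)
  moreover obtain \<psi> where "dirichlet_character (d1 * d2) \<psi>"
    and \<psi>_eq: "\<And>a. coprime a (int (m * n)) \<Longrightarrow> \<eta>1 a * \<eta>2 a = \<psi> a"
    using ind by (auto simp: induced_from_def)
  ultimately obtain \<psi>1 \<psi>2 where \<psi>: "dirichlet_character d1 \<psi>1" "dirichlet_character d2 \<psi>2"
    and "\<psi> = (\<lambda>a. \<psi>1 a * \<psi>2 a)"
    using dirichlet_character_decompose by blast
  with \<psi>_eq have eq: "\<And>a. coprime a (int (m * n)) \<Longrightarrow> \<eta>1 a * \<eta>2 a = \<psi>1 a * \<psi>2 a"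
    by simp
  have "\<eta>1 a = \<psi>1 a" if a: "coprime a (int m)" for a
  proof -
    obtain b where b: "[b = a] (mod int m)" "[b = 1] (mod int n)"
      using exists_cong_and_cong_1[OF cop] by blast
    have "coprime b (int m)" "coprime b (int n)"
      using cong_imp_coprime[OF cong_sym[OF b(1)]] cong_imp_coprime[OF cong_sym[OF b(2)]] a
      by auto
    then have "\<eta>1 b * \<eta>2 b = \<psi>1 b * \<psi>2 b" by (intro eq) simp
    moreover have "[b = a] (mod int d1)" "[b = 1] (mod int d2)"
      using b d by (meson cong_dvd_modulus of_nat_dvd_iff)+
    ultimately show ?thesis
      using dirichlet_character_cong[OF \<eta>(1) b(1)] dirichlet_character_cong[OF \<eta>(2) b(2)]
        dirichlet_character_cong[OF \<psi>(1)] dirichlet_character_cong[OF \<psi>(2)]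
        dirichlet_character_1[OF \<eta>(2)] dirichlet_character_1[OF \<psi>(2)]
      by (metis mult.right_neutral)
  qed
  with \<psi>(1) show ?thesis by (auto simp: induced_from_def)
qed

lemma induced_from_product:
  assumes "induced_from m d \<eta>1" "dirichlet_character n \<eta>2"
  shows "induced_from (m * n) (d * n) (\<lambda>a. \<eta>1 a * \<eta>2 a)"
proof -
  obtain \<psi> where "dirichlet_character d \<psi>" "\<And>a. coprime a (int m) \<Longrightarrow> \<eta>1 a = \<psi> a"
    using assms(1) by (auto simp: induced_from_def)
  then show ?thesis
    unfolding induced_from_def
    by (intro exI[of _ "\<lambda>a. \<psi> a * \<eta>2 a"]) (auto intro: dirichlet_character_product assms(2))
qed

text \<open>If one factor is induced from a proper divisor d of its modulus, the product is induced
  from d times the other modulus. Conversely, a divisor of m n splits as \<open>d1 * d2\<close> and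
  both factors are induced from these parts, so primitivity forces \<open>d1\<close> and
  \<open>d2\<close> to be the full moduli.\<close>

lemma primitive_product_iff:
  assumes cop: "coprime m n" and pos: "m > 0" "n > 0"
    and \<eta>: "dirichlet_character m \<eta>1" "dirichlet_character n \<eta>2"
  shows "(\<lambda>a. \<eta>1 a * \<eta>2 a) \<in> primitive_characters (m * n) \<longleftrightarrow>
    \<eta>1 \<in> primitive_characters m \<and> \<eta>2 \<in> primitive_characters n"
proof
  assume *: "(\<lambda>a. \<eta>1 a * \<eta>2 a) \<in> primitive_characters (m * n)"
  then have not_ind: "\<not> induced_from (m * n) d (\<lambda>a. \<eta>1 a * \<eta>2 a)"
    if "d dvd m * n" "d < m * n" for d
    using that primitive_characters_iff[of "m * n"] pos by auto
  have "\<not> induced_from m d \<eta>1" if "d dvd m" "d < m" for d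
    using not_ind[of "d * n"] induced_from_product[OF _ \<eta>(2)] that pos by fastforce
  moreover have "\<not> induced_from n d \<eta>2" if "d dvd n" "d < n" for d
    using not_ind[of "d * m"] induced_from_product[OF _ \<eta>(1)] that pos
    by (fastforce simp: mult.commute)
  ultimately show "\<eta>1 \<in> primitive_characters m \<and> \<eta>2 \<in> primitive_characters n"
    using \<eta> pos by (simp add: primitive_characters_iff)
next
  assume *: "\<eta>1 \<in> primitive_characters m \<and> \<eta>2 \<in> primitive_characters n"
  have "\<not> induced_from (m * n) d (\<lambda>a. \<eta>1 a * \<eta>2 a)" if d: "d dvd m * n" "d < m * n" for d
  proof
    assume ind: "induced_from (m * n) d (\<lambda>a. \<eta>1 a * \<eta>2 a)"
    obtain d1 d2 where d12: "d = d1 * d2" "d1 dvd m" "d2 dvd n"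
      using division_decomp[OF d(1)] by blast
    have "induced_from m d1 \<eta>1"
      using induced_from_component[OF cop d12(2,3) \<eta>] ind d12 by simp
    moreover have "induced_from n d2 \<eta>2"
      using induced_from_component[OF _ d12(3,2) \<eta>(2,1)] ind d12 cop
      by (simp add: mult.commute coprime_commute)
    ultimately have "\<not> d1 < m" "\<not> d2 < n"
      using * d12 pos by (auto simp: primitive_characters_iff)
    then have "m * n \<le> d" unfolding d12 by (intro mult_le_mono) auto
    with d show False by simp
  qed
  then show "(\<lambda>a. \<eta>1 a * \<eta>2 a) \<in> primitive_characters (m * n)"
    using pos \<eta> by (auto simp: primitive_characters_iff intro: dirichlet_character_product)
qed

text \<open>Pointwise multiplication is a bijection from pairs of characters onto the characters
  modulo m n, and it restricts to a bijection between the primitive ones. Both cardinalities are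
  therefore multiplicative.\<close>

lemma primitive_proportion_mult:
  assumes cop: "coprime m n" and pos: "m > 0" "n > 0"
  shows "primitive_proportion (m * n) = primitive_proportion m * primitive_proportion n"
proof -
  let ?f = "\<lambda>(\<eta>1 :: int \<Rightarrow> complex, \<eta>2 :: int \<Rightarrow> complex) a. \<eta>1 a * \<eta>2 a"
  have inj: "inj_on ?f (dirichlet_characters m \<times> dirichlet_characters n)"
  proof (rule inj_onI)
    fix x y
    assume x: "x \<in> dirichlet_characters m \<times> dirichlet_characters n"
      and y: "y \<in> dirichlet_characters m \<times> dirichlet_characters n" and eq: "?f x = ?f y"
    have eq': "fst x a * snd x a = fst y a * snd y a" for a
      using fun_cong[OF eq, of a] by (simp add: case_prod_beta)
    have "fst x = fst y"
      by (rule dirichlet_character_product_inject[OF cop, of _ "snd x" _ "snd y"])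
         (use x y eq' in \<open>auto simp: dirichlet_characters_def\<close>)
    moreover have "snd x = snd y"
      by (rule dirichlet_character_product_inject[of n m _ "fst x" _ "fst y"])
         (use x y eq' cop in \<open>auto simp: dirichlet_characters_def mult.commute coprime_commute\<close>)
    ultimately show "x = y" by (simp add: prod_eq_iff)
  qed
  have img: "?f ` (dirichlet_characters m \<times> dirichlet_characters n) = dirichlet_characters (m * n)"
  proof (intro equalityI subsetI)
    fix \<eta> assume "\<eta> \<in> dirichlet_characters (m * n)"
    then obtain \<eta>1 \<eta>2 where "dirichlet_character m \<eta>1" "dirichlet_character n \<eta>2"
      "\<eta> = (\<lambda>a. \<eta>1 a * \<eta>2 a)"
      using dirichlet_character_decompose cop by (metis dirichlet_characters_def mem_Collect_eq)
    then show "\<eta> \<in> ?f ` (dirichlet_characters m \<times> dirichlet_characters n)"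
      by (intro image_eqI[of _ _ "(\<eta>1, \<eta>2)"]) (auto simp: dirichlet_characters_def)
  qed (auto simp: dirichlet_characters_def intro: dirichlet_character_product)
  have sub: "primitive_characters n \<subseteq> dirichlet_characters n" for n
    by (auto simp: primitive_characters_def)
  have "?f ` (primitive_characters m \<times> primitive_characters n) = primitive_characters (m * n)"
  proof (intro equalityI subsetI)
    fix \<eta> assume "\<eta> \<in> ?f ` (primitive_characters m \<times> primitive_characters n)"
    then obtain \<eta>1 \<eta>2 where *: "\<eta>1 \<in> primitive_characters m" "\<eta>2 \<in> primitive_characters n"
      "\<eta> = (\<lambda>a. \<eta>1 a * \<eta>2 a)"
      by auto
    then have "dirichlet_character m \<eta>1" "dirichlet_character n \<eta>2"
      by (simp_all add: primitive_characters_def dirichlet_characters_def)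
    then show "\<eta> \<in> primitive_characters (m * n)"
      using primitive_product_iff[OF cop pos] * by simp
  next
    fix \<eta> assume \<eta>: "\<eta> \<in> primitive_characters (m * n)"
    then have "dirichlet_character (m * n) \<eta>"
      by (simp add: primitive_characters_def dirichlet_characters_def)
    then obtain \<eta>1 \<eta>2 where *: "dirichlet_character m \<eta>1" "dirichlet_character n \<eta>2"
      "\<eta> = (\<lambda>a. \<eta>1 a * \<eta>2 a)"
      using dirichlet_character_decompose cop by metis
    then have "\<eta>1 \<in> primitive_characters m" "\<eta>2 \<in> primitive_characters n"
      using primitive_product_iff[OF cop pos *(1,2)] \<eta> by simp_all
    then show "\<eta> \<in> ?f ` (primitive_characters m \<times> primitive_characters n)"
      using * by (intro image_eqI[of _ _ "(\<eta>1, \<eta>2)"]) auto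
  qed
  then have "card (primitive_characters (m * n)) =
      card (primitive_characters m) * card (primitive_characters n)"
    using card_image[OF inj_on_subset[OF inj Sigma_mono[OF sub sub]]]
    by (simp add: card_cartesian_product)
  moreover have "card (dirichlet_characters (m * n)) =
      card (dirichlet_characters m) * card (dirichlet_characters n)"
    using card_image[OF inj] img by (simp add: card_cartesian_product)
  ultimately show ?thesis by (simp add: primitive_proportion_def)
qed

section \<open>The proportion at 4 and at odd primes\<close>

lemma primitive_characters_eq_nonprincipal:
  assumes "n > 1" and div: "\<And>d. d dvd n \<Longrightarrow> d < n \<Longrightarrow> d = 1 \<or> d = 2"
  shows "primitive_characters n = dirichlet_characters n - {principal_character n}"
proof -
  \<comment> \<open>Modulus 1 is a proper divisor because n > 1, so the principal character is
    imprimitive.\<close>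
  have "induced_from n 1 (principal_character n)"
    unfolding induced_from_def
    by (intro exI[of _ "principal_character 1"] conjI dirichlet_character_principal)
       (simp add: principal_character_def)
  then have "principal_character n \<notin> primitive_characters n"
    using primitive_characters_iff[of n] \<open>n > 1\<close> one_dvd[of n] by (metis gr0I not_less_zero)
  moreover have "\<eta> = principal_character n"
    if \<eta>: "\<eta> \<in> dirichlet_characters n" "\<eta> \<notin> primitive_characters n" for \<eta>
  proof -
    have \<eta>': "dirichlet_character n \<eta>" using \<eta>(1) by (simp add: dirichlet_characters_def)
    obtain d where d: "d dvd n" "d < n" "induced_from n d \<eta>"
      using primitive_characters_iff[of n \<eta>] \<eta>(2) \<eta>' \<open>n > 1\<close> by auto
    then obtain \<psi> where \<psi>: "dirichlet_character d \<psi>" "\<And>a. coprime a (int n) \<Longrightarrow> \<eta> a = \<psi> a"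
      by (auto simp: induced_from_def)
    \<comment> \<open>A unit modulo n is a unit modulo its divisor d, and for d = 1 or d = 2 the
      only unit class is that of 1.\<close>
    have "\<eta> a = 1" if a: "coprime a (int n)" for a
    proof -
      have "coprime a (int d)" using a d(1) by (meson coprime_divisors dvd_refl of_nat_dvd_iff)
      then have "[a = 1] (mod int d)"
        using div[OF d(1,2)] by (auto simp: cong_def mod_2_eq_odd)
      then show ?thesis
        using dirichlet_character_cong[OF \<psi>(1)] dirichlet_character_1[OF \<psi>(1)] \<psi>(2)[OF a] by metis
    qed
    then show ?thesis
      using dirichlet_character_eq_0_iff[OF \<eta>'] by (auto simp: principal_character_def)
  qed
  moreover have "primitive_characters n \<subseteq> dirichlet_characters n"
    by (auto simp: primitive_characters_def)
  ultimately show ?thesis by blast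
qed

lemma primitive_proportion_cyclic:
  assumes "n > 1" and "\<And>d. d dvd n \<Longrightarrow> d < n \<Longrightarrow> d = 1 \<or> d = 2" and "n \<in> cyclic_moduli"
  shows "primitive_proportion n = (real (totient n) - 1) / real (totient n)"
proof -
  obtain g where "residue_primroot n g"
    using assms(3) residue_primroot_iff_in_cyclic_moduli by blast
  then have card: "card (dirichlet_characters n) = totient n"
    using card_dirichlet_characters_primroot assms(1) by blast
  have pos: "totient n > 0" using assms(1) by simp
  have "principal_character n \<in> dirichlet_characters n"
    by (simp add: dirichlet_characters_def dirichlet_character_principal)
  then have "card (primitive_characters n) = totient n - 1"
    using primitive_characters_eq_nonprincipal[OF assms(1,2)] card by simp
  moreover have "real (totient n - 1) = real (totient n) - 1"
    using pos by (simp only: of_nat_diff Suc_leI One_nat_def)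
  ultimately show ?thesis using card by (simp add: primitive_proportion_def)
qed

lemma primitive_proportion_4: "primitive_proportion 4 = 1 / 2"
proof -
  have "d = 1 \<or> d = 2" if "d dvd 4" "d < 4" for d :: nat
  proof -
    from that have "d \<in> {0, 1, 2, 3}" by auto
    with that show ?thesis by auto
  qed
  moreover have "totient 4 = 2"
    using totient_prime_power[of 2 2] two_is_prime_nat by simp
  ultimately show ?thesis
    using primitive_proportion_cyclic[of 4] by (simp add: cyclic_moduli_def)
qed

lemma primitive_proportion_odd_prime:
  assumes "prime p" "p > 2"
  shows "primitive_proportion p = (real p - 2) / (real p - 1)"
proof -
  have "odd p" using assms prime_odd_nat by blast
  then have "p \<in> cyclic_moduli"
    using assms unfolding cyclic_moduli_def
    by (intro UnI1 UnI2 CollectI exI[of _ p] exI[of _ 1]) auto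
  then have "primitive_proportion p = (real (totient p) - 1) / real (totient p)"
    using assms by (intro primitive_proportion_cyclic) (auto simp: prime_nat_iff)
  then show ?thesis using assms by (simp add: totient_prime of_nat_diff)
qed

text \<open>The number 4 is the 2-part of twice a primorial. Without the doubling the 2-part would
  be 2, which has no primitive characters, and the proportion would vanish.\<close>

lemma primitive_proportion_4_times_odd_primes:
  assumes "finite S" "\<And>p. p \<in> S \<Longrightarrow> prime p \<and> p > 2"
  shows "primitive_proportion (4 * \<Prod>S) = 1 / 2 * (\<Prod>p\<in>S. (real p - 2) / (real p - 1))"
  using assms
proof (induction S rule: finite_induct)
  case empty
  then show ?case by (simp add: primitive_proportion_4)
next
  case (insert q S)
  have q: "prime q" "q > 2" using insert.prems by auto
  have "coprime q p" if "p \<in> S" for p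
    using that insert.hyps insert.prems q by (intro primes_coprime) auto
  then have "coprime q (\<Prod>S)" by (intro prod_coprime_right) auto
  moreover have "coprime q 4"
    using q prime_odd_nat[of q] coprime_power_right_iff[of q 2 2] by (simp add: coprime_commute)
  ultimately have "coprime (4 * \<Prod>S) q" by (simp add: coprime_commute)
  moreover have "4 * \<Prod>S > 0"
    using insert.prems insert.hyps by (auto intro!: prod_pos simp: prime_gt_0_nat)
  ultimately have "primitive_proportion (4 * \<Prod>S * q) =
      primitive_proportion (4 * \<Prod>S) * ((real q - 2) / (real q - 1))"
    using q primitive_proportion_mult[of "4 * \<Prod>S" q] primitive_proportion_odd_prime[OF q]
    by (simp add: prime_gt_0_nat)
  also have "4 * \<Prod>S * q = 4 * \<Prod>(insert q S)"
    using insert.hyps by (simp add: mult_ac)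
  also have "primitive_proportion (4 * \<Prod>S) = 1 / 2 * (\<Prod>p\<in>S. (real p - 2) / (real p - 1))"
    using insert.prems by (intro insert.IH) auto
  finally show ?case using insert.hyps by simp
qed

section \<open>Mertens' first and second theorems\<close>

definition primes_upto :: "nat \<Rightarrow> nat set" where
  "primes_upto n = {p. prime p \<and> p \<le> n}"

lemma finite_primes_upto [simp, intro]: "finite (primes_upto n)"
  by (simp add: primes_upto_def)

lemma primes_upto_0 [simp]: "primes_upto 0 = {}"
  by (auto simp: primes_upto_def)

lemma primes_upto_Suc:
  "primes_upto (Suc n) = (if prime (Suc n) then insert (Suc n) (primes_upto n) else primes_upto n)"
  by (auto simp: primes_upto_def le_Suc_eq)

lemma not_in_primes_upto: "n < p \<Longrightarrow> p \<notin> primes_upto n"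
  by (simp add: primes_upto_def)

text \<open>This turns sums over primes into partial sums of series over all natural numbers, to
  which the theory of \<open>summable\<close> and \<open>suminf\<close> applies.\<close>

lemma sum_primes_upto:
  "sum f (primes_upto n) = (\<Sum>k\<le>n. if prime k then f k else 0)"
  by (auto simp: primes_upto_def sum.If_cases intro!: sum.cong)

lemma prod_primes_dvd:
  fixes n :: nat
  assumes "finite S" "\<And>p. p \<in> S \<Longrightarrow> prime p \<and> p dvd n"
  shows "\<Prod>S dvd n"
  using assms
proof (induction S rule: finite_induct)
  case (insert q S)
  have "coprime q (\<Prod>S)"
    using insert by (intro prod_coprime_right) (metis insert_iff primes_coprime)
  then show ?case using insert by (simp add: divides_mult)
qed simp

text \<open>Erdos's argument: an even n > 2 adds no prime. For n = 2m + 1 the primes between m + 2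
  and n all divide the binomial coefficient n over m, which is at most 4^m because it occurs twice
  in a row with sum 2 * 4^m. The primes up to m + 1 are left to the induction hypothesis.\<close>

lemma prod_primes_upto_le: "\<Prod>(primes_upto n) \<le> 4 ^ n"
proof (induction n rule: less_induct)
  case (less n)
  show ?case
  proof (cases "n \<le> 2")
    case True
    then consider "n = 0" | "n = 1" | "n = 2" by linarith
    then show ?thesis
      by cases (simp_all add: primes_upto_Suc numeral_2_eq_2)
  next
    case False
    show ?thesis
    proof (cases "even n")
      case True
      then obtain m where m: "n = Suc m" using False by (cases n) auto
      have "\<not> prime n" using True False prime_odd_nat[of n] by auto
      then have "\<Prod>(primes_upto n) = \<Prod>(primes_upto m)" by (simp add: m primes_upto_Suc)
      also have "\<dots> \<le> 4 ^ m" using less.IH[of m] m by simp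
      also have "\<dots> \<le> 4 ^ n" by (simp add: m)
      finally show ?thesis .
    next
      case False
      then obtain m where m: "n = 2 * m + 1" by (elim oddE)
      with \<open>\<not> n \<le> 2\<close> have "m \<ge> 1" by simp
      let ?S = "{p. prime p \<and> m + 1 < p \<and> p \<le> n}"
      let ?B = "n choose m"
      have "\<Prod>?S dvd ?B"
      proof (rule prod_primes_dvd)
        fix p assume p: "p \<in> ?S"
        have "fact m * fact (n - m) * ?B = (fact n :: nat)"
          using m by (intro binomial_fact_lemma) simp
        then have "p dvd fact m * fact (n - m) * ?B"
          using p by (simp add: prime_dvd_fact_iff)
        moreover have "\<not> p dvd fact m" "\<not> p dvd fact (n - m)"
          using p m by (subst prime_dvd_fact_iff; auto)+
        ultimately show "prime p \<and> p dvd ?B"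
          using p by (auto simp: prime_dvd_mult_iff)
      qed simp
      then have "\<Prod>?S \<le> ?B" using m by (intro dvd_imp_le) auto
      also have "?B \<le> 4 ^ m"
      proof -
        have "n choose (m + 1) = ?B"
          using binomial_symmetric[of m n] m by simp
        then have "2 * ?B = (\<Sum>k\<in>{m, m + 1}. n choose k)" by simp
        also have "\<dots> \<le> (\<Sum>k\<le>n. n choose k)"
          using m by (intro sum_mono2) auto
        also have "\<dots> = 2 * 4 ^ m"
          by (simp only: choose_row_sum m) (simp add: power_mult)
        finally show ?thesis by simp
      qed
      finally have 1: "\<Prod>?S \<le> 4 ^ m" .
      have "primes_upto n = primes_upto (m + 1) \<union> ?S"
        using m by (auto simp: primes_upto_def)
      then have "\<Prod>(primes_upto n) = \<Prod>(primes_upto (m + 1)) * \<Prod>?S"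
        by (simp only:) (intro prod.union_disjoint, auto simp: primes_upto_def)
      also have "\<dots> \<le> 4 ^ (m + 1) * 4 ^ m"
        using less.IH[of "m + 1"] m \<open>m \<ge> 1\<close> 1 by (intro mult_le_mono) auto
      also have "\<dots> = 4 ^ n" by (simp add: m power_add [symmetric] flip: mult_2)
      finally show ?thesis .
    qed
  qed
qed

definition chebyshev_theta :: "nat \<Rightarrow> real" where
  "chebyshev_theta n = (\<Sum>p\<in>primes_upto n. ln (real p))"

lemma chebyshev_theta_eq_ln_prod: "chebyshev_theta n = ln (real (\<Prod>(primes_upto n)))"
  unfolding chebyshev_theta_def of_nat_prod
  by (intro ln_prod [symmetric]) (auto simp: primes_upto_def prime_gt_0_nat)

lemma chebyshev_theta_le: "chebyshev_theta n \<le> real n * ln 4"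
proof -
  have "real (\<Prod>(primes_upto n)) \<le> 4 ^ n"
    using prod_primes_upto_le[of n] by (metis of_nat_le_iff of_nat_numeral of_nat_power)
  moreover have "real (\<Prod>(primes_upto n)) > 0"
    by (auto simp: primes_upto_def prime_gt_0_nat intro!: prod_pos)
  ultimately have "ln (real (\<Prod>(primes_upto n))) \<le> ln (4 ^ n)" by simp
  then show ?thesis by (simp add: chebyshev_theta_eq_ln_prod ln_realpow)
qed

section \<open>Prime factorisation of factorials\<close>

lemma fact_prime_decompose:
  fixes p :: nat
  assumes "prime p"
  shows "\<exists>c. \<not> p dvd c \<and> fact n = p ^ (n div p) * fact (n div p) * c"
proof (induction n)
  case 0
  then show ?case using assms by (intro exI[of _ 1]) (auto simp: prime_nat_iff)
next
  case (Suc n)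
  then obtain c where c: "\<not> p dvd c" "fact n = p ^ (n div p) * fact (n div p) * c" by blast
  have p0: "p > 0" using assms by (simp add: prime_gt_0_nat)
  \<comment> \<open>A new multiple of p supplies one more factor p and extends the inner factorial.
    Any other number joins the cofactor c.\<close>
  show ?case
  proof (cases "p dvd Suc n")
    case True
    then have div: "Suc n div p = Suc (n div p)" using p0 by (simp add: div_Suc dvd_eq_mod_eq_0)
    then have "Suc n = p * Suc (n div p)" using True by (metis dvd_mult_div_cancel)
    then have "fact (Suc n) = p * Suc (n div p) * fact n" by (metis fact_Suc of_nat_id)
    then have "fact (Suc n) = p ^ Suc (n div p) * fact (Suc (n div p)) * c"
      by (simp add: c(2) algebra_simps)
    then show ?thesis using c(1) div by auto
  next
    case False
    then have "Suc n div p = n div p" by (simp add: div_Suc dvd_eq_mod_eq_0)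
    moreover have "\<not> p dvd c * Suc n"
      using c(1) False prime_dvd_multD[OF assms] by blast
    ultimately show ?thesis
      using c by (intro exI[of _ "c * Suc n"]) (simp add: fact_Suc mult_ac del: mult_Suc mult_Suc_right)
  qed
qed

text \<open>The cofactor in \<open>fact_prime_decompose\<close> is prime to p, so only the explicit
  power and the smaller factorial count. Unrolled, the recursion is Legendre's formula.\<close>

lemma multiplicity_fact_rec:
  fixes p :: nat
  assumes "prime p"
  shows "multiplicity p (fact n :: nat) = n div p + multiplicity p (fact (n div p) :: nat)"
proof -
  obtain c where c: "\<not> p dvd c" "fact n = p ^ (n div p) * fact (n div p) * c"
    using fact_prime_decompose[OF assms] by blast
  have "c \<noteq> 0" using c(1) by (metis dvd_0_right)
  then have "multiplicity p (fact n :: nat) =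
      multiplicity p (p ^ (n div p)) + multiplicity p (fact (n div p) :: nat) + multiplicity p c"
    using assms unfolding c(2)
    by (subst prime_elem_multiplicity_mult_distrib | auto)+
  then show ?thesis
    using c assms by (simp add: not_dvd_imp_multiplicity_0 prime_elem_multiplicity_power_distrib
        multiplicity_same_power prime_gt_0_nat)
qed

text \<open>Legendre's formula is dominated by a geometric series with sum n / (p - 1). Clearing the
  denominator keeps the induction in the natural numbers.\<close>

lemma multiplicity_fact_upper:
  fixes p :: nat
  assumes "prime p"
  shows "multiplicity p (fact n :: nat) * (p - 1) \<le> n"
proof (induction n rule: less_induct)
  case (less n)
  show ?case
  proof (cases "n = 0")
    case False
    define k where "k = n div p"
    have p: "p > 1" by (rule prime_gt_1_nat) (rule assms)
    have "k < n" using False p by (simp add: k_def)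
    have "multiplicity p (fact n :: nat) * (p - 1) = k * (p - 1) + multiplicity p (fact k :: nat) * (p - 1)"
      by (simp add: multiplicity_fact_rec[OF assms, of n] k_def distrib_right)
    also have "\<dots> \<le> k * (p - 1) + k" using less.IH[OF \<open>k < n\<close>] by simp
    also have "\<dots> = k * p" using p by (cases p) auto
    also have "\<dots> \<le> n" by (simp add: k_def)
    finally show ?thesis .
  qed simp
qed

lemma ln_fact_eq_sum_primes:
  "ln (fact n) = (\<Sum>p\<in>primes_upto n. real (multiplicity p (fact n :: nat)) * ln (real p))"
proof -
  have pf: "prime_factors (fact n :: nat) = primes_upto n"
    by (auto simp: primes_upto_def prime_factors_dvd prime_dvd_fact_iff)
  have "(fact n :: nat) = (\<Prod>p\<in>primes_upto n. p ^ multiplicity p (fact n :: nat))"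
    using prime_factorization_nat[of "fact n"] pf by simp
  then have "real (fact n :: nat) = (\<Prod>p\<in>primes_upto n. real p ^ multiplicity p (fact n :: nat))"
    by (metis (no_types, lifting) of_nat_power of_nat_prod prod.cong)
  then have "ln (fact n) = ln (\<Prod>p\<in>primes_upto n. real p ^ multiplicity p (fact n :: nat))"
    by simp
  also have "\<dots> = (\<Sum>p\<in>primes_upto n. ln (real p ^ multiplicity p (fact n :: nat)))"
    by (intro ln_prod) (auto simp: primes_upto_def prime_gt_0_nat)
  also have "\<dots> = (\<Sum>p\<in>primes_upto n. real (multiplicity p (fact n :: nat)) * ln (real p))"
    by (intro sum.cong refl ln_realpow)
  finally show ?thesis .
qed

text \<open>A weak Stirling estimate. The induction step amounts to n * ln (1 + 1/n) \<le>
  1.\<close>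

lemma ln_fact_lower: "ln (fact n) \<ge> real n * ln (real n) - real n"
proof (cases "n = 0")
  case False
  then have "n > 0" by simp
  then show ?thesis
  proof (induction n rule: nat_induct_non_zero)
    case (Suc n)
    have "1 + 1 / real n = real (Suc n) / real n" using Suc.hyps by (simp add: field_simps)
    then have "ln (real (Suc n)) - ln (real n) = ln (1 + 1 / real n)"
      using Suc.hyps by (simp add: ln_div del: of_nat_Suc)
    also have "\<dots> \<le> 1 / real n" by (intro ln_add_one_self_le_self) simp
    finally have "real n * (ln (real (Suc n)) - ln (real n)) \<le> 1"
      using Suc.hyps by (simp add: field_simps)
    moreover have "ln (fact (Suc n)) = ln (real (Suc n)) + ln (fact n)"
      by (simp add: ln_mult del: of_nat_Suc)
    ultimately show ?case using Suc.IH by (simp add: algebra_simps)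
  qed simp
qed simp

lemma ln_fact_upper: "n > 0 \<Longrightarrow> ln (fact n) \<le> real n * ln (real n)"
proof -
  assume n: "n > 0"
  have "(fact n :: real) \<le> real n ^ n" using fact_le_power[of n] by simp
  then have "ln (fact n) \<le> ln (real n ^ n)" using n by (subst ln_le_cancel_iff) auto
  then show ?thesis using n by (simp add: ln_realpow)
qed

lemma sum_ln_over_p_squared_bounded:
  "\<exists>C. \<forall>n. (\<Sum>p\<in>primes_upto n. ln (real p) / (real p * (real p - 1))) \<le> C"
proof -
  \<comment> \<open>The majorant combines ln p \<le> 2 * sqrt p with p - 1 \<ge> p / 2.\<close>
  let ?g = "\<lambda>k::nat. 4 * real k powr (-3/2)"
  have "summable ?g" by (intro summable_mult) (simp add: summable_real_powr_iff)
  have "(\<Sum>p\<in>primes_upto n. ln (real p) / (real p * (real p - 1))) \<le> suminf ?g" for n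
  proof -
    have "(\<Sum>p\<in>primes_upto n. ln (real p) / (real p * (real p - 1))) \<le> sum ?g (primes_upto n)"
    proof (rule sum_mono)
      fix p assume "p \<in> primes_upto n"
      then have p: "p \<ge> 2" by (auto simp: primes_upto_def prime_ge_2_nat)
      have "ln (real p) = 2 * ln (sqrt (real p))" using p by (simp add: ln_sqrt)
      also have "\<dots> \<le> 2 * sqrt (real p)" using ln_le_minus_one[of "sqrt (real p)"] p by simp
      finally have 1: "ln (real p) \<le> 2 * sqrt (real p)" .
      have "real p * (real p - 1) \<ge> real p * (real p / 2)" using p by (intro mult_left_mono) auto
      then have "ln (real p) / (real p * (real p - 1)) \<le> 2 * sqrt (real p) / (real p * (real p / 2))"
        using 1 p by (intro frac_le) auto
      also have "\<dots> = 4 * (real p powr (1/2) / real p powr 2)"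
        using p by (simp add: powr_half_sqrt power2_eq_square)
      also have "\<dots> = ?g p" by (simp only: powr_diff [symmetric]) simp
      finally show "ln (real p) / (real p * (real p - 1)) \<le> ?g p" .
    qed
    also have "\<dots> \<le> suminf ?g"
      using \<open>summable ?g\<close> by (intro sum_le_suminf) auto
    finally show ?thesis .
  qed
  then show ?thesis by blast
qed

section \<open>Mertens' first theorem and the order of \<theta>\<close>

definition mertens_sum :: "nat \<Rightarrow> real" where
  "mertens_sum n = (\<Sum>p\<in>primes_upto n. ln (real p) / real p)"

lemma mertens_first: "\<exists>C>0. \<forall>n\<ge>1. \<bar>mertens_sum n - ln (real n)\<bar> \<le> C"
proof -
  obtain C where C: "\<And>n. (\<Sum>p\<in>primes_upto n. ln (real p) / (real p * (real p - 1))) \<le> C"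
    using sum_ln_over_p_squared_bounded by blast
  have "\<bar>mertens_sum n - ln (real n)\<bar> \<le> \<bar>C\<bar> + 2" if n: "n \<ge> 1" for n
  proof -
    \<comment> \<open>Upper estimate: the multiplicity of p in n! is at least n div p > n / p - 1.
      The total loss from rounding is \<theta>(n), which Chebyshev's bound makes O(n).\<close>
    have "real n * mertens_sum n - chebyshev_theta n = (\<Sum>p\<in>primes_upto n. (real n / real p - 1) * ln (real p))"
      by (simp add: mertens_sum_def chebyshev_theta_def sum_distrib_left sum_subtractf algebra_simps)
    also have "\<dots> \<le> ln (fact n)"
      unfolding ln_fact_eq_sum_primes
    proof (intro sum_mono mult_right_mono)
      fix p assume "p \<in> primes_upto n"
      then have p: "prime p" "p > 0" by (auto simp: primes_upto_def prime_gt_0_nat)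
      have "real n / real p - 1 \<le> real (n div p)"
        using p floor_divide_of_nat_eq[of n p, where ?'a = real] by linarith
      also have "\<dots> \<le> real (multiplicity p (fact n :: nat))"
        by (simp add: multiplicity_fact_rec[OF p(1), of n])
      finally show "real n / real p - 1 \<le> real (multiplicity p (fact n :: nat))" .
      show "ln (real p) \<ge> 0" using p by simp
    qed
    also have "\<dots> \<le> real n * ln (real n)" using n by (intro ln_fact_upper) simp
    finally have "real n * mertens_sum n \<le> real n * ln (real n) + real n * ln 4"
      using chebyshev_theta_le[of n] by linarith
    then have "real n * mertens_sum n \<le> real n * (ln (real n) + ln 4)" by (simp add: algebra_simps)
    then have 1: "mertens_sum n \<le> ln (real n) + ln 4" using n by simp
    have "ln (4 :: real) = 2 * ln 2" using ln_realpow[of 2 2] by simp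
    also have "\<dots> \<le> 2" using ln_le_minus_one[of "2 :: real"] by simp
    finally have ln4: "ln (4 :: real) \<le> 2" .
    \<comment> \<open>Lower estimate: the multiplicity is at most n / (p - 1), and 1 / (p - 1) = 1 /
      p + 1 / (p (p - 1)), where the second part contributes a bounded sum.\<close>
    have "real n * ln (real n) - real n \<le> ln (fact n)" by (rule ln_fact_lower)
    also have "\<dots> \<le> (\<Sum>p\<in>primes_upto n. real n * (ln (real p) / real p + ln (real p) / (real p * (real p - 1))))"
      unfolding ln_fact_eq_sum_primes
    proof (intro sum_mono)
      fix p assume "p \<in> primes_upto n"
      then have p: "prime p" "p \<ge> 2" by (auto simp: primes_upto_def prime_ge_2_nat)
      have "real (multiplicity p (fact n :: nat) * (p - 1)) \<le> real n"
        using multiplicity_fact_upper[OF p(1), of n] by (simp only: of_nat_le_iff)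
      then have "real (multiplicity p (fact n :: nat)) * (real p - 1) \<le> real n"
        using p by (simp add: of_nat_diff)
      then have "real (multiplicity p (fact n :: nat)) \<le> real n / (real p - 1)"
        using p by (simp add: field_simps)
      then have "real (multiplicity p (fact n :: nat)) * ln (real p) \<le> real n / (real p - 1) * ln (real p)"
        using p by (intro mult_right_mono) auto
      also have "\<dots> = real n * (ln (real p) / real p + ln (real p) / (real p * (real p - 1)))"
        using p by (simp add: divide_simps) (simp add: algebra_simps)
      finally show "real (multiplicity p (fact n :: nat)) * ln (real p) \<le>
        real n * (ln (real p) / real p + ln (real p) / (real p * (real p - 1)))" .
    qed
    also have "\<dots> = real n * (mertens_sum n + (\<Sum>p\<in>primes_upto n. ln (real p) / (real p * (real p - 1))))"
      by (simp add: mertens_sum_def sum.distrib sum_distrib_left [symmetric])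
    also have "\<dots> \<le> real n * (mertens_sum n + C)"
      using C[of n] by (intro mult_left_mono) auto
    finally have "real n * (ln (real n) - 1) \<le> real n * (mertens_sum n + C)"
      by (simp add: algebra_simps)
    then have 2: "ln (real n) - 1 \<le> mertens_sum n + C" using n by simp
    show ?thesis using 1 2 ln4 by linarith
  qed
  then show ?thesis by (intro exI[of _ "\<bar>C\<bar> + 2"]) auto
qed

text \<open>By Mertens' first theorem the primes between n / K and n carry a fixed amount of
  \<open>mertens_sum\<close> once K is large. Their weights 1 / p are of order at most K / n, so
  \<theta>(n) must be at least of order n.\<close>

lemma chebyshev_theta_lower: "\<exists>c>0. \<forall>\<^sub>F n in sequentially. chebyshev_theta n \<ge> c * real n"
proof -
  obtain C where C: "C > 0" "\<And>n. n \<ge> 1 \<Longrightarrow> \<bar>mertens_sum n - ln (real n)\<bar> \<le> C"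
    using mertens_first by blast
  \<comment> \<open>The part 2 C of the exponent absorbs the two errors of the first theorem. The
    remaining 2 gives \<theta>(n) \<ge> 2 m, and 2 m \<ge> m + 1 \<ge> n / K.\<close>
  define K where "K = exp (2 * C + 2)"
  have K: "K > 1" using C(1) by (simp add: K_def)
  have "chebyshev_theta n \<ge> 1 / K * real n" if n: "real n \<ge> K" for n
  proof -
    define m where "m = nat \<lfloor>real n / K\<rfloor>"
    have "real n / K \<ge> 1" using n K by simp
    then have m: "m \<ge> 1" "real m \<le> real n / K" "real n / K \<le> real m + 1"
      unfolding m_def by linarith+
    have "real n / K \<le> real n / 1" using K by (intro divide_left_mono) auto
    then have mn: "m \<le> n" "n \<ge> 1" using m by linarith+
    have "ln (real m) \<le> ln (real n / K)" using m by simp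
    also have "\<dots> = ln (real n) - (2 * C + 2)" using mn K by (simp add: ln_div K_def)
    finally have "2 \<le> mertens_sum n - mertens_sum m"
      using C(2)[OF m(1)] C(2)[OF mn(2)] by linarith
    also have "\<dots> = (\<Sum>p\<in>primes_upto n - primes_upto m. ln (real p) / real p)"
      unfolding mertens_sum_def using mn
      by (subst sum_diff) (auto simp: primes_upto_def)
    also have "\<dots> \<le> (\<Sum>p\<in>primes_upto n - primes_upto m. ln (real p) / real m)"
      using m by (intro sum_mono divide_left_mono) (auto simp: primes_upto_def not_le prime_gt_0_nat)
    also have "\<dots> \<le> (\<Sum>p\<in>primes_upto n. ln (real p) / real m)"
      using m by (intro sum_mono2) (auto simp: primes_upto_def prime_gt_0_nat Suc_le_eq)
    also have "\<dots> = chebyshev_theta n / real m"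
      by (simp add: chebyshev_theta_def sum_divide_distrib)
    finally have "2 * real m \<le> chebyshev_theta n" using m by (simp add: field_simps)
    then show ?thesis using m by simp
  qed
  then have "\<forall>\<^sub>F n in sequentially. chebyshev_theta n \<ge> 1 / K * real n"
    using filterlim_real_sequentially unfolding filterlim_at_top
    by (auto elim!: eventually_mono dest!: spec[of _ K])
  then show ?thesis using K by (intro exI[of _ "1 / K"]) auto
qed

text \<open>Since \<theta>(n) lies between constant multiples of n, the constants disappear in the
  ratio of logarithms. The summand \<open>ln 2\<close> is the logarithm of the factor 2 in twice a
  primorial.\<close>

lemma ln_chebyshev_theta_asymp:
  "(\<lambda>n. ln (chebyshev_theta n + ln 2) / ln (real n)) \<longlonglongrightarrow> 1"
proof -
  obtain c where c: "c > 0" "\<forall>\<^sub>F n in sequentially. chebyshev_theta n \<ge> c * real n"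
    using chebyshev_theta_lower by blast
  show ?thesis
  proof (rule tendsto_sandwich)
    show "\<forall>\<^sub>F n in sequentially. ln (c * real n) / ln (real n) \<le> ln (chebyshev_theta n + ln 2) / ln (real n)"
      using c(2) eventually_gt_at_top[of 1]
    proof eventually_elim
      case (elim n)
      have "0 < c * real n" using elim c(1) by simp
      moreover have "c * real n \<le> chebyshev_theta n + ln 2" using elim by (simp add: add_increasing2)
      ultimately show ?case using elim by (intro divide_right_mono) auto
    qed
    show "\<forall>\<^sub>F n in sequentially. ln (chebyshev_theta n + ln 2) / ln (real n) \<le> ln (real n * ln 4 + ln 2) / ln (real n)"
      using c(2) eventually_gt_at_top[of 1]
    proof eventually_elim
      case (elim n)
      have "0 < c * real n" using elim c(1) by simp
      then have "0 < chebyshev_theta n + ln 2" using elim by (simp add: add_pos_pos)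
      then show ?case using elim chebyshev_theta_le[of n] by (intro divide_right_mono) auto
    qed
    show "(\<lambda>n. ln (c * real n) / ln (real n)) \<longlonglongrightarrow> 1" using c(1) by real_asymp
    show "(\<lambda>n. ln (real n * ln 4 + ln 2) / ln (real n)) \<longlonglongrightarrow> 1" by real_asymp
  qed
qed

section \<open>Mertens' second theorem\<close>

definition prime_reciprocal_sum :: "nat \<Rightarrow> real" where
  "prime_reciprocal_sum n = (\<Sum>p\<in>primes_upto n. 1 / real p)"

lemma mertens_second: "\<exists>M. (\<lambda>n. prime_reciprocal_sum n - ln (ln (real n))) \<longlonglongrightarrow> M"
proof -
  obtain C where C: "C > 0" "\<And>n. n \<ge> 1 \<Longrightarrow> \<bar>mertens_sum n - ln (real n)\<bar> \<le> C"
    using mertens_first by blast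
  \<comment> \<open>Abel summation: the increments of \<open>V\<close> are dominated by those of the telescoping \<open>-1 / ln n\<close>.\<close>
  define V where "V n = prime_reciprocal_sum n - mertens_sum n / ln (real n) - ln (ln (real n))" for n
  define \<delta> where "\<delta> n = 1 / ln (real n) - 1 / ln (real (Suc n))" for n :: nat
  have V_bound: "\<bar>V (Suc n) - V n\<bar> \<le> (C + 1) * \<delta> n" if n: "n \<ge> 2" for n
  proof -
    define u v where "u = ln (real n)" and "v = ln (real (Suc n))"
    have u: "u > 0" using n by (simp add: u_def)
    have uv: "u < v" using n by (simp add: u_def v_def)
    have "1 + 1 / real n = real (Suc n) / real n" using n by (simp add: field_simps)
    then have "v - u = ln (1 + 1 / real n)"
      using n by (simp add: u_def v_def ln_div del: of_nat_Suc)
    also have "\<dots> \<le> 1 / real n" by (intro ln_add_one_self_le_self) simp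
    also have "\<dots> \<le> 1" using n by simp
    finally have vu: "v - u \<le> 1" .
    have \<delta>: "\<delta> n = 1 / u - 1 / v" by (simp add: \<delta>_def u_def v_def)
    have \<delta>_nonneg: "\<delta> n \<ge> 0" using u uv by (simp add: \<delta> frac_le)
    have "prime_reciprocal_sum (Suc n) - prime_reciprocal_sum n = (mertens_sum (Suc n) - mertens_sum n) / v"
      using n uv u by (auto simp: prime_reciprocal_sum_def mertens_sum_def primes_upto_Suc
          v_def not_in_primes_upto simp del: of_nat_Suc)
    then have "V (Suc n) - V n = mertens_sum n * \<delta> n - (ln v - ln u)"
      unfolding V_def \<delta> by (simp add: u_def [symmetric] v_def [symmetric] diff_divide_distrib
          right_diff_distrib del: of_nat_Suc)
    \<comment> \<open>The first summand is controlled by the first theorem. The second is the error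
      in replacing the increment of \<open>ln (ln n)\<close> by u * \<delta>; it lies between
      -\<delta> and 0, using v - u \<le> 1 for the lower end.\<close>
    also have "\<dots> = (mertens_sum n - u) * \<delta> n + (u * \<delta> n - (ln v - ln u))"
      by (simp add: algebra_simps)
    finally have V_eq: "V (Suc n) - V n = (mertens_sum n - u) * \<delta> n + (u * \<delta> n - (ln v - ln u))" .
    have ln_diff: "ln v - ln u = ln (v / u)" "ln v - ln u = - ln (u / v)"
      using u uv by (simp_all add: ln_div)
    have "u * \<delta> n = 1 - u / v" using u by (simp add: \<delta> right_diff_distrib)
    moreover have "ln (u / v) \<le> u / v - 1" using u uv by (intro ln_le_minus_one) simp
    ultimately have upper: "u * \<delta> n - (ln v - ln u) \<le> 0" using ln_diff by linarith
    have "v * \<delta> n = v / u - 1" using u uv by (simp add: \<delta> right_diff_distrib)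
    moreover have "ln (v / u) \<le> v / u - 1" using u uv by (intro ln_le_minus_one) simp
    ultimately have "ln v - ln u \<le> v * \<delta> n" using ln_diff by linarith
    moreover have "(v - u) * \<delta> n \<le> 1 * \<delta> n" using vu \<delta>_nonneg by (intro mult_right_mono)
    ultimately have lower: "u * \<delta> n - (ln v - ln u) \<ge> - \<delta> n" by (simp add: algebra_simps)
    have "\<bar>(mertens_sum n - u) * \<delta> n\<bar> \<le> C * \<delta> n"
      using C(2)[of n] n \<delta>_nonneg by (simp add: abs_mult u_def mult_right_mono)
    then show ?thesis using upper lower unfolding V_eq by (simp add: algebra_simps)
  qed
  \<comment> \<open>The shift by 2 begins the series where \<open>ln\<close> is positive.\<close>
  have lim0: "(\<lambda>n. 1 / ln (real (n + 2))) \<longlonglongrightarrow> 0" by real_asymp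
  have "summable (\<lambda>n. \<delta> (n + 2))"
    using telescope_summable'[OF lim0] by (simp add: \<delta>_def)
  then have "summable (\<lambda>n. (C + 1) * \<delta> (n + 2))" by (rule summable_mult)
  then have "summable (\<lambda>n. V (Suc (n + 2)) - V (n + 2))"
    by (rule summable_comparison_test') (use V_bound in auto)
  moreover have "(\<Sum>k<n. V (Suc (k + 2)) - V (k + 2)) = V (n + 2) - V 2" for n
    by (induction n) (simp_all add: numeral_2_eq_2)
  ultimately have "convergent (\<lambda>n. V (n + 2) - V 2)"
    by (simp only: summable_iff_convergent)
  then obtain L where "(\<lambda>n. V (n + 2) - V 2) \<longlonglongrightarrow> L" by (auto simp: convergent_def)
  then have "(\<lambda>n. V (n + 2) - V 2 + V 2) \<longlonglongrightarrow> L + V 2" by (intro tendsto_intros)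
  then have "(\<lambda>n. V (n + 2)) \<longlonglongrightarrow> L + V 2" by (simp only: diff_add_cancel)
  then have V_lim: "V \<longlonglongrightarrow> L + V 2" by (rule LIMSEQ_offset)
  \<comment> \<open>This is the boundary term of the Abel summation that was subtracted in
    V.\<close>
  have A_lim: "(\<lambda>n. mertens_sum n / ln (real n)) \<longlonglongrightarrow> 1"
  proof (rule tendsto_sandwich)
    have "(ln (real n) - C) / ln (real n) \<le> mertens_sum n / ln (real n)"
      "mertens_sum n / ln (real n) \<le> (ln (real n) + C) / ln (real n)" if "n > 1" for n
      using C(2)[of n] that by (intro divide_right_mono; simp)+
    then show "\<forall>\<^sub>F n in sequentially. (ln (real n) - C) / ln (real n) \<le> mertens_sum n / ln (real n)"
      "\<forall>\<^sub>F n in sequentially. mertens_sum n / ln (real n) \<le> (ln (real n) + C) / ln (real n)"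
      by (intro eventually_sequentiallyI[of 2]; simp)+
    show "(\<lambda>n. (ln (real n) - C) / ln (real n)) \<longlonglongrightarrow> 1" by real_asymp
    show "(\<lambda>n. (ln (real n) + C) / ln (real n)) \<longlonglongrightarrow> 1" by real_asymp
  qed
  have "(\<lambda>n. V n + mertens_sum n / ln (real n)) \<longlonglongrightarrow> L + V 2 + 1"
    by (intro tendsto_add V_lim A_lim)
  then show ?thesis by (intro exI[of _ "L + V 2 + 1"]) (simp add: V_def algebra_simps)
qed

section \<open>The Euler product on the real axis\<close>

text \<open>Integral comparison for \<zeta>(1 + \<sigma>): the increments of the negative
  antiderivative g lie between consecutive terms by the mean value theorem, and they telescope to
  g(1) = 1 / \<sigma>. The bounds express the simple pole at 1.\<close>

lemma zeta_bounds:
  fixes \<sigma> :: real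
  assumes \<sigma>: "\<sigma> > 0"
  defines "\<zeta> \<equiv> (\<Sum>n. real (Suc n) powr (-1 - \<sigma>))"
  shows "1 / \<sigma> \<le> \<zeta>" "\<zeta> \<le> 1 / \<sigma> + 1"
proof -
  define g where "g x = x powr (-\<sigma>) / \<sigma>" for x :: real
  have mvt: "\<exists>\<xi>. a < \<xi> \<and> \<xi> < a + 1 \<and> g a - g (a + 1) = \<xi> powr (-1 - \<sigma>)" if "a > 0" for a
  proof -
    have "(g has_real_derivative - (x powr (-1 - \<sigma>))) (at x)" if "a \<le> x" "x \<le> a + 1" for x
    proof -
      have "(g has_real_derivative - (x powr (- \<sigma> - 1))) (at x)"
        unfolding g_def using that \<open>a > 0\<close> \<sigma>
        by (auto intro!: derivative_eq_intros simp: field_simps)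
      moreover have "- \<sigma> - 1 = -1 - \<sigma>" by simp
      ultimately show ?thesis by (simp only:)
    qed
    then obtain \<xi> where "a < \<xi>" "\<xi> < a + 1" "g (a + 1) - g a = (a + 1 - a) * (- (\<xi> powr (-1 - \<sigma>)))"
      using MVT2[of a "a + 1" g "\<lambda>x. - (x powr (-1 - \<sigma>))"] by auto
    then show ?thesis by (intro exI[of _ \<xi>]) auto
  qed
  have lower: "g (real (Suc n)) - g (real (Suc (Suc n))) \<le> real (Suc n) powr (-1 - \<sigma>)"
    and upper: "real (Suc (Suc n)) powr (-1 - \<sigma>) \<le> g (real (Suc n)) - g (real (Suc (Suc n)))" for n
  proof -
    obtain \<xi> where \<xi>: "real (Suc n) < \<xi>" "\<xi> < real (Suc n) + 1"
      "g (real (Suc n)) - g (real (Suc n) + 1) = \<xi> powr (-1 - \<sigma>)"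
      using mvt[of "real (Suc n)"] by auto
    have "\<xi> > 0" using \<xi>(1) by (rule less_trans[rotated]) simp
    have "real (Suc n) + 1 = real (Suc (Suc n))" by simp
    note \<xi>' = \<xi>[unfolded this]
    show "g (real (Suc n)) - g (real (Suc (Suc n))) \<le> real (Suc n) powr (-1 - \<sigma>)"
      and "real (Suc (Suc n)) powr (-1 - \<sigma>) \<le> g (real (Suc n)) - g (real (Suc (Suc n)))"
      using \<xi>' \<open>\<xi> > 0\<close> \<sigma> powr_mono2'[of "-1 - \<sigma>" "real (Suc n)" \<xi>]
        powr_mono2'[of "-1 - \<sigma>" \<xi> "real (Suc (Suc n))"]
      by (simp_all del: of_nat_Suc)
  qed
  have summable: "summable (\<lambda>n. real (Suc n) powr (-1 - \<sigma>))"
    using \<sigma> by (subst summable_Suc_iff) (simp add: summable_real_powr_iff)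
  have "(\<lambda>n. g (real (Suc n))) \<longlonglongrightarrow> 0"
    unfolding g_def using \<sigma> by real_asymp
  then have tele: "(\<lambda>n. g (real (Suc n)) - g (real (Suc (Suc n)))) sums (g (real (Suc 0)) - 0)"
    by (rule telescope_sums')
  have g1: "g (real (Suc 0)) - 0 = 1 / \<sigma>" by (simp add: g_def)
  show "1 / \<sigma> \<le> \<zeta>"
    using sums_le[OF lower tele summable_sums[OF summable]] g1 by (simp add: \<zeta>_def)
  have "(\<Sum>n. real (Suc (Suc n)) powr (-1 - \<sigma>)) \<le> 1 / \<sigma>"
  proof -
    have "summable (\<lambda>n. real (Suc (Suc n)) powr (-1 - \<sigma>))"
      using summable by (subst summable_Suc_iff)
    then show ?thesis using sums_le[OF upper summable_sums tele] g1 by simp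
  qed
  moreover have "\<zeta> = 1 + (\<Sum>n. real (Suc (Suc n)) powr (-1 - \<sigma>))"
    using suminf_split_head[OF summable] by (simp add: \<zeta>_def)
  ultimately show "\<zeta> \<le> 1 / \<sigma> + 1" by simp
qed

text \<open>Sieving by one more prime q: the multiples of q among the integers free of P are q times
  that same set, since no prime of P divides q. By multiplicativity they carry the fraction
  \<open>f q\<close> of its sum.\<close>

lemma euler_product_partial:
  fixes f :: "nat \<Rightarrow> real"
  assumes mult: "\<And>a b. f (a * b) = f a * f b" and summable: "f summable_on UNIV"
    and "finite P" "\<And>p. p \<in> P \<Longrightarrow> prime p"
  shows "infsum f {n. n > 0 \<and> (\<forall>p\<in>P. \<not> p dvd n)} = (\<Prod>p\<in>P. 1 - f p) * infsum f {n. n > 0}"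
  using assms(3,4)
proof (induction P rule: finite_induct)
  case (insert q P)
  define X where "X = {n :: nat. n > 0 \<and> (\<forall>p\<in>P. \<not> p dvd n)}"
  define Y where "Y = {n :: nat. n > 0 \<and> (\<forall>p\<in>insert q P. \<not> p dvd n)}"
  have q: "prime q" "q > 0" using insert.prems by (auto simp: prime_gt_0_nat)
  have "\<not> p dvd q" if "p \<in> P" for p
    using that insert.hyps insert.prems q primes_dvd_imp_eq[of p q] by auto
  then have dvd: "p dvd q * n \<longleftrightarrow> p dvd n" if "p \<in> P" for p n
    using that insert.prems by (simp add: prime_dvd_mult_iff)
  have "X = Y \<union> (\<lambda>n. q * n) ` X"
  proof (intro equalityI subsetI)
    fix n assume n: "n \<in> X"
    show "n \<in> Y \<union> (\<lambda>n. q * n) ` X"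
    proof (cases "q dvd n")
      case True
      then obtain m where m: "n = q * m" by (elim dvdE)
      then have "m \<in> X" using n dvd by (auto simp: X_def)
      then show ?thesis using m by blast
    qed (use n in \<open>auto simp: X_def Y_def\<close>)
  qed (use q dvd in \<open>auto simp: X_def Y_def\<close>)
  moreover have "Y \<inter> (\<lambda>n. q * n) ` X = {}" by (auto simp: Y_def)
  moreover have sub: "f summable_on A" for A
    using summable by (rule summable_on_subset_banach) simp
  ultimately have "infsum f X = infsum f Y + infsum f ((\<lambda>n. q * n) ` X)"
    using infsum_Un_disjoint[of f Y "(\<lambda>n. q * n) ` X"] by metis
  also have "infsum f ((\<lambda>n. q * n) ` X) = infsum (\<lambda>n. f q * f n) X"
    using q by (subst infsum_reindex) (auto simp: inj_on_def o_def mult)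
  also have "\<dots> = f q * infsum f X" by (intro infsum_cmult_right sub)
  finally have "infsum f Y = (1 - f q) * infsum f X" unfolding left_diff_distrib by linarith
  also have "infsum f X = (\<Prod>p\<in>P. 1 - f p) * infsum f {n. n > 0}"
    unfolding X_def using insert.prems by (intro insert.IH) auto
  finally show ?case
    using insert.hyps unfolding Y_def by (simp add: mult.assoc)
qed simp

text \<open>The product with zeta is the sum over integers without prime factors up to N. Besides 1
  these all exceed N, so the sum lies between 1 and 1 plus a tail of a convergent series.\<close>

lemma euler_product_zeta:
  fixes s :: real
  assumes s: "s > 1"
  shows "(\<lambda>N. (\<Prod>p\<in>primes_upto N. 1 - real p powr (-s)) * (\<Sum>n. real (Suc n) powr (-s))) \<longlonglongrightarrow> 1"
proof -
  define f where "f n = real n powr (-s)" for n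
  have summable: "summable f" using s by (simp add: f_def [abs_def] summable_real_powr_iff)
  have nonneg: "f n \<ge> 0" for n by (simp add: f_def)
  have summable_on: "f summable_on UNIV"
    using summable nonneg by (subst summable_on_UNIV_nonneg_real_iff) auto
  have f0: "f 0 = 0" by (simp add: f_def)
  have infsum_UNIV: "infsum f UNIV = suminf f"
    using summable_on by (metis has_sum_imp_sums has_sum_infsum sums_unique)
  have "infsum f {n. n > 0} = infsum f UNIV"
    by (rule infsum_cong_neutral) (auto simp: f0)
  also have "\<dots> = (\<Sum>n. real (Suc n) powr (-s))"
    using suminf_split_head[OF summable] f0 by (simp add: infsum_UNIV f_def)
  finally have zeta: "infsum f {n. n > 0} = (\<Sum>n. real (Suc n) powr (-s))" .
  define R where "R N = infsum f {n. n > 0 \<and> (\<forall>p\<in>primes_upto N. \<not> p dvd n)}" for N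
  have R_eq: "R N = (\<Prod>p\<in>primes_upto N. 1 - f p) * infsum f {n. n > 0}" for N
    unfolding R_def using summable_on
    by (intro euler_product_partial) (auto simp: f_def powr_mult primes_upto_def)
  have sub: "f summable_on A" for A
    using summable_on by (rule summable_on_subset_banach) simp
  have R_lower: "1 \<le> R N" for N
  proof -
    have "f 1 = infsum f {1}" by simp
    also have "\<dots> \<le> R N"
      unfolding R_def using nonneg
      by (intro infsum_mono_neutral sub) (auto simp: primes_upto_def)
    finally show ?thesis by (simp add: f_def)
  qed
  have R_upper: "R N \<le> 1 + (suminf f - sum f {..N})" for N
  proof -
    have "n > N" if n: "n > 0" "\<forall>p\<in>primes_upto N. \<not> p dvd n" "n \<noteq> 1" for n
    proof (rule ccontr)
      assume "\<not> n > N"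
      obtain p where p: "prime p" "p dvd n" using prime_factor_nat[OF n(3)] by blast
      then have "p \<le> n" using n by (intro dvd_imp_le) auto
      then show False using p n \<open>\<not> n > N\<close> by (auto simp: primes_upto_def)
    qed
    then have "{n. n > 0 \<and> (\<forall>p\<in>primes_upto N. \<not> p dvd n)} \<subseteq> {1} \<union> {N<..}" by auto
    then have "R N \<le> infsum f ({1} \<union> {N<..})"
      unfolding R_def using nonneg by (intro infsum_mono_neutral sub) auto
    also have "\<dots> \<le> infsum f {1} + infsum f {N<..}"
    proof (cases "N = 0")
      \<comment> \<open>For N = 0 the number 1 already lies in the tail, so the union is not
        disjoint and only the inequality holds.\<close>
      case True
      then have "{1} \<union> {N<..} = {N<..}" by auto
      then show ?thesis using nonneg[of 1] by simp
    next
      case False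
      then show ?thesis by (subst infsum_Un_disjoint) (auto intro: sub)
    qed
    also have "infsum f {N<..} = suminf f - sum f {..N}"
    proof -
      have "infsum f UNIV = infsum f {..N} + infsum f {N<..}"
        by (subst infsum_Un_disjoint [symmetric]) (auto intro!: sub arg_cong2[of _ _ _ _ infsum])
      then show ?thesis by (simp add: infsum_UNIV)
    qed
    finally show ?thesis by (simp add: f_def)
  qed
  have "(\<lambda>N. sum f {..N}) \<longlonglongrightarrow> suminf f" using summable by (rule summable_LIMSEQ')
  then have "(\<lambda>N. 1 + (suminf f - sum f {..N})) \<longlonglongrightarrow> 1 + (suminf f - suminf f)"
    by (intro tendsto_intros)
  then have "R \<longlonglongrightarrow> 1"
    using R_lower R_upper by (intro tendsto_sandwich[of "\<lambda>_. 1" R]) auto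
  then have "(\<lambda>N. (\<Prod>p\<in>primes_upto N. 1 - f p) * infsum f {n. n > 0}) \<longlonglongrightarrow> 1"
    by (rule Lim_transform_eventually) (simp add: R_eq)
  then show ?thesis unfolding zeta by (simp add: f_def)
qed

section \<open>Abel's limit theorem\<close>

text \<open>The factor 1 - x normalises the weights x^n to total 1. The terms with small t
  contribute at most e / 2, and the finitely many others are suppressed as x tends to 1.\<close>

lemma abel_limit_zero:
  fixes t :: "nat \<Rightarrow> real"
  assumes "t \<longlonglongrightarrow> 0"
  shows "((\<lambda>x. (1 - x) * (\<Sum>n. t n * x ^ n)) \<longlongrightarrow> 0) (at_left 1)"
proof -
  obtain B where B: "\<And>n. \<bar>t n\<bar> \<le> B" and "B > 0"
    using convergent_imp_Bseq[of t] assms by (auto simp: convergent_def Bseq_def)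
  have summable: "summable (\<lambda>n. \<bar>t n\<bar> * x ^ n)" if "0 < x" "x < 1" for x
  proof (rule summable_comparison_test')
    show "summable (\<lambda>n. B * x ^ n)" using that by (intro summable_mult summable_geometric) auto
    show "norm (\<bar>t n\<bar> * x ^ n) \<le> B * x ^ n" for n
      using that B by (simp add: abs_mult mult_right_mono)
  qed
  show ?thesis
  proof (rule tendstoI)
    fix e :: real assume e: "e > 0"
    obtain N where N: "\<And>n. n \<ge> N \<Longrightarrow> \<bar>t n\<bar> \<le> e / 2"
      using LIMSEQ_D[OF assms, of "e / 2"] e by force
    \<comment> \<open>The added 1 makes D positive even if all initial terms vanish.\<close>
    define D where "D = (\<Sum>n<N. \<bar>t n\<bar>) + 1"
    have D: "D > 0" by (simp add: D_def add_nonneg_pos sum_nonneg)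
    have "\<forall>\<^sub>F x in at_left 1. max 0 (1 - e / (2 * D)) < x"
      using D e by (intro eventually_at_leftI[of "max 0 (1 - e / (2 * D))"]) auto
    moreover have "\<forall>\<^sub>F x in at_left (1::real). x < 1" by (simp add: eventually_at_left_field eventually_at_filter)
    ultimately show "\<forall>\<^sub>F x in at_left 1. dist ((1 - x) * (\<Sum>n. t n * x ^ n)) 0 < e"
    proof eventually_elim
      case (elim x)
      then have x: "0 < x" "x < 1" "1 - x < e / (2 * D)" by auto
      have geo: "summable (\<lambda>n. e / 2 * x ^ n)" using x by (intro summable_mult summable_geometric) auto
      have fin: "summable (\<lambda>n. if n < N then \<bar>t n\<bar> else 0)" by (intro summable_finite[of "{..<N}"]) auto
      have "\<bar>\<Sum>n. t n * x ^ n\<bar> \<le> (\<Sum>n. \<bar>t n * x ^ n\<bar>)"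
        using summable[OF x(1,2)] x by (intro summable_rabs) (simp add: abs_mult)
      also have "\<dots> \<le> (\<Sum>n. (if n < N then \<bar>t n\<bar> else 0) + e / 2 * x ^ n)"
      proof (intro suminf_le summable_add geo fin)
        show "summable (\<lambda>n. \<bar>t n * x ^ n\<bar>)" using summable[OF x(1,2)] x by (simp add: abs_mult)
        fix n
        show "\<bar>t n * x ^ n\<bar> \<le> (if n < N then \<bar>t n\<bar> else 0) + e / 2 * x ^ n"
        proof (cases "n < N")
          case True
          have "\<bar>t n\<bar> * x ^ n \<le> \<bar>t n\<bar> * 1"
            using x by (intro mult_left_mono power_le_one) auto
          moreover have "0 \<le> e / 2 * x ^ n" using e x by simp
          ultimately show ?thesis using True x by (simp add: abs_mult)
        next
          case False
          then show ?thesis using N[of n] x by (simp add: abs_mult mult_right_mono)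
        qed
      qed
      also have "\<dots> = (\<Sum>n. if n < N then \<bar>t n\<bar> else 0) + (\<Sum>n. e / 2 * x ^ n)"
        by (intro suminf_add [symmetric] fin geo)
      also have "(\<Sum>n. if n < N then \<bar>t n\<bar> else 0) = (\<Sum>n<N. \<bar>t n\<bar>)"
        by (subst suminf_finite[of "{..<N}"]) auto
      also have "(\<Sum>n. e / 2 * x ^ n) = e / 2 * (1 / (1 - x))"
        using x by (subst suminf_mult) (auto intro: summable_geometric simp: suminf_geometric)
      finally have "\<bar>\<Sum>n. t n * x ^ n\<bar> \<le> D + e / 2 * (1 / (1 - x))" by (simp add: D_def)
      then have "(1 - x) * \<bar>\<Sum>n. t n * x ^ n\<bar> \<le> (1 - x) * (D + e / 2 * (1 / (1 - x)))"
        using x by (intro mult_left_mono) auto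
      also have "\<dots> = (1 - x) * D + e / 2" using x by (simp add: field_simps)
      also have "(1 - x) * D < e / 2" using x(3) D by (simp add: field_simps)
      finally show ?case using x by (simp add: abs_mult)
    qed
  qed
qed

text \<open>Summation by parts expresses the power series as L plus 1 - x times the series of the
  errors t of the partial sums, and these errors tend to 0.\<close>

lemma abel_limit:
  fixes c :: "nat \<Rightarrow> real"
  assumes "c sums L"
  shows "((\<lambda>x. \<Sum>n. c n * x ^ n) \<longlongrightarrow> L) (at_left 1)"
proof -
  define t where "t n = (\<Sum>k\<le>n. c k) - L" for n
  have "(\<lambda>n. \<Sum>k\<le>n. c k) \<longlonglongrightarrow> L" using assms by (simp add: sums_def_le)
  then have "(\<lambda>n. (\<Sum>k\<le>n. c k) - L) \<longlonglongrightarrow> L - L" by (intro tendsto_intros)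
  then have t: "t \<longlonglongrightarrow> 0" by (simp add: t_def [abs_def])
  have "(\<Sum>n. c n * x ^ n) = L + (1 - x) * (\<Sum>n. t n * x ^ n)" if x: "0 < x" "x < 1" for x
  proof -
    obtain B where B: "\<And>n. \<bar>t n\<bar> \<le> B"
      using convergent_imp_Bseq[of t] t by (auto simp: convergent_def Bseq_def)
    have summable_t: "summable (\<lambda>n. t n * x ^ n)"
    proof (rule summable_comparison_test')
      show "summable (\<lambda>n. B * x ^ n)" using x by (intro summable_mult summable_geometric) auto
      show "norm (t n * x ^ n) \<le> B * x ^ n" for n
        using x B by (simp add: abs_mult mult_right_mono)
    qed
    \<comment> \<open>This is t shifted by one place. The initial value -L is the error of the empty
      partial sum, so c n = t n - u n also holds at n = 0.\<close>
    define u where "u n = (case n of 0 \<Rightarrow> - L | Suc m \<Rightarrow> t m)" for n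
    have u: "(\<lambda>n. u n * x ^ n) sums (- L + x * (\<Sum>n. t n * x ^ n))"
    proof -
      have "(\<lambda>n. x * (t n * x ^ n)) sums (x * (\<Sum>n. t n * x ^ n))"
        by (intro sums_mult summable_sums summable_t)
      then have "(\<lambda>n. u (Suc n) * x ^ Suc n) sums (x * (\<Sum>n. t n * x ^ n))"
        by (simp add: u_def mult_ac)
      then have "(\<lambda>n. u n * x ^ n) sums (x * (\<Sum>n. t n * x ^ n) + u 0 * x ^ 0)"
        by (rule sums_Suc)
      then show ?thesis by (simp add: u_def add.commute)
    qed
    have "c n = t n - u n" for n
      by (cases n) (simp_all add: t_def u_def)
    then have "(\<lambda>n. c n * x ^ n) sums ((\<Sum>n. t n * x ^ n) - (- L + x * (\<Sum>n. t n * x ^ n)))"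
      using sums_diff[OF summable_sums[OF summable_t] u] by (simp add: left_diff_distrib)
    then show ?thesis by (simp add: sums_unique [symmetric] algebra_simps)
  qed
  then have "\<forall>\<^sub>F x in at_left 1. L + (1 - x) * (\<Sum>n. t n * x ^ n) = (\<Sum>n. c n * x ^ n)"
    by (intro eventually_at_leftI[of 0]) auto
  moreover have "((\<lambda>x. L + (1 - x) * (\<Sum>n. t n * x ^ n)) \<longlongrightarrow> L + 0) (at_left 1)"
    by (intro tendsto_intros abel_limit_zero t)
  ultimately show ?thesis by (simp add: tendsto_cong)
qed

section \<open>The constant in Mertens' third theorem\<close>

lemma ln_one_minus_remainder_bounds:
  fixes y :: real
  assumes "0 \<le> y" "y \<le> 1 / 2"
  shows "0 \<le> - ln (1 - y) - y" "- ln (1 - y) - y \<le> 2 * y\<^sup>2"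
  using assms ln_one_minus_pos_lower_bound[of y] ln_one_minus_pos_upper_bound[of y] by auto

text \<open>The argument is shifted: this is the prime zeta function at \<open>1 + \<sigma>\<close>.\<close>

definition prime_zeta :: "real \<Rightarrow> real" where
  "prime_zeta \<sigma> = (\<Sum>n. if prime n then real n powr (-1 - \<sigma>) else 0)"

text \<open>The share of the higher prime powers (exponent at least 2) in the logarithm of the Euler
  factor. Its sum over primes still converges at \<sigma> = 0, unlike that of the leading
  terms.\<close>

definition log_euler_remainder :: "real \<Rightarrow> nat \<Rightarrow> real" where
  "log_euler_remainder \<sigma> n =
     (if prime n then - ln (1 - real n powr (-1 - \<sigma>)) - real n powr (-1 - \<sigma>) else 0)"

lemma prime_powr_le:
  fixes p :: nat
  assumes "prime p" "\<sigma> \<ge> 0"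
  shows "real p powr (-1 - \<sigma>) \<le> 1 / real p" "real p powr (-1 - \<sigma>) \<le> 1 / 2"
proof -
  have p: "p \<ge> 2" using assms by (simp add: prime_ge_2_nat)
  have "real p powr (-1 - \<sigma>) \<le> real p powr (-1)" using p assms by (intro powr_mono) auto
  also have "\<dots> = 1 / real p" using p by (simp add: powr_minus_divide)
  finally show "real p powr (-1 - \<sigma>) \<le> 1 / real p" .
  also have "\<dots> \<le> 1 / 2" using p by (intro divide_left_mono) auto
  finally show "real p powr (-1 - \<sigma>) \<le> 1 / 2" .
qed

text \<open>The majorant is independent of \<sigma>, as dominated convergence for \<sigma>
  \<rightarrow> 0 requires.\<close>

lemma log_euler_remainder_bounds:
  assumes "\<sigma> \<ge> 0"
  shows "0 \<le> log_euler_remainder \<sigma> n" "log_euler_remainder \<sigma> n \<le> 2 * real n powr (-2)"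
proof -
  have "0 \<le> log_euler_remainder \<sigma> n \<and> log_euler_remainder \<sigma> n \<le> 2 * real n powr (-2)"
  proof (cases "prime n")
    case True
    define y where "y = real n powr (-1 - \<sigma>)"
    have y: "0 \<le> y" "y \<le> 1 / real n" "y \<le> 1 / 2"
      using prime_powr_le[OF True assms] by (simp_all add: y_def)
    have "y\<^sup>2 \<le> (1 / real n)\<^sup>2" using y by (intro power_mono) auto
    also have "\<dots> = real n powr (-2)"
      using True by (simp add: powr_minus_divide power_divide prime_gt_0_nat)
    finally show ?thesis
      using ln_one_minus_remainder_bounds[OF y(1,3)] True by (simp add: log_euler_remainder_def y_def)
  qed (simp add: log_euler_remainder_def)
  then show "0 \<le> log_euler_remainder \<sigma> n" "log_euler_remainder \<sigma> n \<le> 2 * real n powr (-2)" by auto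
qed

lemma summable_log_euler_remainder:
  assumes "\<sigma> \<ge> 0"
  shows "summable (log_euler_remainder \<sigma>)"
proof (rule summable_comparison_test')
  show "summable (\<lambda>n. 2 * real n powr (-2))" by (intro summable_mult) (simp add: summable_real_powr_iff)
  show "norm (log_euler_remainder \<sigma> n) \<le> 2 * real n powr (-2)" for n
    using log_euler_remainder_bounds[OF assms, of n] by simp
qed

lemma log_euler_remainder_tendsto:
  "((\<lambda>\<sigma>. suminf (log_euler_remainder \<sigma>)) \<longlongrightarrow> suminf (log_euler_remainder 0)) (at_right 0)"
proof -
  have lim: "((\<lambda>\<sigma>. log_euler_remainder \<sigma> n) \<longlongrightarrow> log_euler_remainder 0 n) (at_right 0)" for n
  proof (cases "prime n")
    case True
    have "real n > 1" using prime_gt_1_nat[OF True] by simp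
    then have n: "real n > 0" "real n powr (-1) < 1" by (simp_all add: powr_minus_divide)
    have "((\<lambda>\<sigma>. real n powr (-1 - \<sigma>)) \<longlongrightarrow> real n powr (-1 - 0)) (at_right 0)"
      using n by (intro tendsto_intros) auto
    then have "((\<lambda>\<sigma>. - ln (1 - real n powr (-1 - \<sigma>)) - real n powr (-1 - \<sigma>)) \<longlongrightarrow>
        - ln (1 - real n powr (-1 - 0)) - real n powr (-1 - 0)) (at_right 0)"
      using n by (intro tendsto_intros) auto
    then show ?thesis using True by (simp add: log_euler_remainder_def)
  qed (simp add: log_euler_remainder_def)
  \<comment> \<open>Tannery's theorem takes its bound along the product filter. Only \<sigma> is
    restricted, so the condition on the index is \<open>True\<close>.\<close>
  have "\<forall>\<^sub>F x in at_top \<times>\<^sub>F at_right 0. True \<and> 0 < (snd x :: real)"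
    by (intro eventually_prodI[of "\<lambda>_. True"] eventually_at_right_less) simp
  then have bound: "\<forall>\<^sub>F (n, \<sigma>) in at_top \<times>\<^sub>F at_right 0.
      norm (log_euler_remainder \<sigma> n) \<le> 2 * real n powr (-2)"
  proof eventually_elim
    case (elim x)
    then show ?case
      using log_euler_remainder_bounds[of "snd x" "fst x"] by (simp add: case_prod_beta)
  qed
  have "summable (\<lambda>n. 2 * real n powr (-2))"
    by (intro summable_mult) (simp add: summable_real_powr_iff)
  from tannerys_theorem[OF lim bound this] show ?thesis by simp
qed

lemma summable_prime_zeta:
  "\<sigma> > 0 \<Longrightarrow> summable (\<lambda>n. if prime n then real n powr (-1 - \<sigma>) else 0)"
  by (rule summable_comparison_test'[of "\<lambda>n. real n powr (-1 - \<sigma>)"])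
     (auto simp: summable_real_powr_iff)

lemma ln_zeta_eq:
  assumes \<sigma>: "\<sigma> > 0"
  shows "ln (\<Sum>n. real (Suc n) powr (-1 - \<sigma>)) = prime_zeta \<sigma> + suminf (log_euler_remainder \<sigma>)"
proof -
  define \<zeta> where "\<zeta> = (\<Sum>n. real (Suc n) powr (-1 - \<sigma>))"
  have "0 < 1 / \<sigma>" using \<sigma> by simp
  then have \<zeta>: "\<zeta> > 0" using zeta_bounds(1)[OF \<sigma>] unfolding \<zeta>_def by linarith
  let ?F = "\<lambda>N. \<Prod>p\<in>primes_upto N. 1 - real p powr (-1 - \<sigma>)"
  have factor: "1 - real p powr (-1 - \<sigma>) > 0" if "p \<in> primes_upto N" for p N
    using prime_powr_le(2)[of p \<sigma>] that \<sigma> by (auto simp: primes_upto_def)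
  have "(\<lambda>N. ?F N * \<zeta>) \<longlonglongrightarrow> 1"
    using euler_product_zeta[of "1 + \<sigma>"] \<sigma> by (simp add: \<zeta>_def)
  then have "(\<lambda>N. ln (?F N * \<zeta>)) \<longlonglongrightarrow> ln 1" by (rule tendsto_ln) simp
  \<comment> \<open>This difference is minus the logarithm of the finite Euler product, which splits
    prime by prime into a prime zeta term and a remainder.\<close>
  then have "(\<lambda>N. ln \<zeta> - ln (?F N * \<zeta>)) \<longlonglongrightarrow> ln \<zeta> - ln 1" by (intro tendsto_diff tendsto_const)
  moreover have "ln \<zeta> - ln (?F N * \<zeta>) =
      (\<Sum>n\<le>N. if prime n then real n powr (-1 - \<sigma>) else 0) + (\<Sum>n\<le>N. log_euler_remainder \<sigma> n)" for N
  proof -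
    have "?F N > 0" using factor by (intro prod_pos) auto
    then have "ln (?F N * \<zeta>) = ln (?F N) + ln \<zeta>" using \<zeta> by (rule ln_mult_pos)
    also have "ln (?F N) = (\<Sum>p\<in>primes_upto N. ln (1 - real p powr (-1 - \<sigma>)))"
      by (intro ln_prod finite_primes_upto) (metis factor less_irrefl)
    also have "\<dots> = (\<Sum>n\<le>N. if prime n then ln (1 - real n powr (-1 - \<sigma>)) else 0)"
      by (rule sum_primes_upto)
    also have "\<dots> = (\<Sum>n\<le>N. - ((if prime n then real n powr (-1 - \<sigma>) else 0) + log_euler_remainder \<sigma> n))"
      by (intro sum.cong) (auto simp: log_euler_remainder_def)
    finally show ?thesis by (simp only: sum_negf sum.distrib)
  qed
  ultimately have "(\<lambda>N. (\<Sum>n\<le>N. if prime n then real n powr (-1 - \<sigma>) else 0) +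
      (\<Sum>n\<le>N. log_euler_remainder \<sigma> n)) \<longlonglongrightarrow> ln \<zeta>" by simp
  moreover have "(\<lambda>N. (\<Sum>n\<le>N. if prime n then real n powr (-1 - \<sigma>) else 0) +
      (\<Sum>n\<le>N. log_euler_remainder \<sigma> n)) \<longlonglongrightarrow> prime_zeta \<sigma> + suminf (log_euler_remainder \<sigma>)"
    unfolding prime_zeta_def using \<sigma>
    by (intro tendsto_add summable_LIMSEQ' summable_prime_zeta summable_log_euler_remainder) auto
  ultimately show ?thesis unfolding \<zeta>_def by (rule LIMSEQ_unique)
qed

section \<open>Dyadic blocks of primes and power series\<close>

definition dyadic_prime_sum :: "nat \<Rightarrow> real" where
  "dyadic_prime_sum n = (\<Sum>p\<in>primes_upto (2 ^ Suc n) - primes_upto (2 ^ n). 1 / real p)"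

lemma sum_dyadic_primes:
  fixes f :: "nat \<Rightarrow> real"
  shows "(\<Sum>n<N. \<Sum>p\<in>primes_upto (2 ^ Suc n) - primes_upto (2 ^ n). f p) = sum f (primes_upto (2 ^ N))"
proof (induction N)
  case 0
  then show ?case by (auto simp: primes_upto_Suc)
next
  case (Suc N)
  have "primes_upto (2 ^ N) \<subseteq> primes_upto (2 ^ Suc N)" by (auto simp: primes_upto_def)
  then show ?case using Suc.IH by (simp add: sum_diff)
qed

text \<open>For 2^n < p \<le> 2^(n+1) the value p^(-\<sigma>) lies between x^(n+1) and x^n.
  Replacing it by x^n throughout a block therefore costs at most a factor x, and the prime zeta
  function becomes comparable to a power series in x.\<close>

lemma dyadic_prime_sum_powser_bounds:
  assumes \<sigma>: "\<sigma> > 0"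
  defines "x \<equiv> 2 powr (-\<sigma>)"
  shows "summable (\<lambda>n. dyadic_prime_sum n * x ^ n)"
    and "prime_zeta \<sigma> \<le> (\<Sum>n. dyadic_prime_sum n * x ^ n)"
    and "x * (\<Sum>n. dyadic_prime_sum n * x ^ n) \<le> prime_zeta \<sigma>"
proof -
  define B where "B n = primes_upto (2 ^ Suc n) - primes_upto (2 ^ n)" for n
  define b where "b n = (\<Sum>p\<in>B n. real p powr (-1 - \<sigma>))" for n
  have x: "x > 0" by (simp add: x_def)
  have x_pow: "(2 ^ n) powr (-\<sigma>) = x ^ n" for n
    by (induction n) (simp_all add: x_def powr_mult)
  have B: "real p powr (-1 - \<sigma>) \<le> 1 / real p * x ^ n" "1 / real p * x ^ Suc n \<le> real p powr (-1 - \<sigma>)"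
    if "p \<in> B n" for p n
  proof -
    have p: "2 ^ n < p" "p \<le> 2 ^ Suc n" using that by (auto simp: B_def primes_upto_def)
    have "real (2 ^ n) \<le> real p" "real p \<le> real (2 ^ Suc n)"
      using p by (simp_all only: of_nat_le_iff less_imp_le)
    then have p': "2 ^ n \<le> real p" "real p \<le> 2 ^ Suc n" by simp_all
    have "p > 0" using p by (cases p) auto
    have eq: "real p powr (-1 - \<sigma>) = 1 / real p * real p powr (-\<sigma>)"
      using \<open>p > 0\<close> powr_add[of "real p" "-1" "-\<sigma>"] by (simp add: powr_minus_divide)
    have "real p powr (-\<sigma>) \<le> (2 ^ n) powr (-\<sigma>)"
      using p' \<sigma> by (intro powr_mono2') auto
    moreover have "(2 ^ Suc n) powr (-\<sigma>) \<le> real p powr (-\<sigma>)"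
      using p' \<sigma> \<open>p > 0\<close> by (intro powr_mono2') auto
    ultimately show "real p powr (-1 - \<sigma>) \<le> 1 / real p * x ^ n"
        "1 / real p * x ^ Suc n \<le> real p powr (-1 - \<sigma>)"
      unfolding eq x_pow by (intro mult_left_mono; simp)+
  qed
  have ub: "b n \<le> dyadic_prime_sum n * x ^ n" for n
    unfolding b_def dyadic_prime_sum_def sum_distrib_right B_def [symmetric] by (intro sum_mono B)
  have lb: "dyadic_prime_sum n * x ^ Suc n \<le> b n" for n
    unfolding b_def dyadic_prime_sum_def sum_distrib_right B_def [symmetric] by (intro sum_mono B)
  have nonneg: "dyadic_prime_sum n \<ge> 0" for n
    unfolding dyadic_prime_sum_def by (intro sum_nonneg) auto
  have "(\<lambda>N. \<Sum>n\<le>N. if prime n then real n powr (-1 - \<sigma>) else 0) \<longlonglongrightarrow> prime_zeta \<sigma>"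
    unfolding prime_zeta_def by (intro summable_LIMSEQ' summable_prime_zeta \<sigma>)
  then have "(\<lambda>N. \<Sum>p\<in>primes_upto N. real p powr (-1 - \<sigma>)) \<longlonglongrightarrow> prime_zeta \<sigma>"
    by (simp add: sum_primes_upto)
  moreover have "filterlim (\<lambda>N::nat. 2 ^ N :: nat) at_top sequentially"
    by (intro filterlim_subseq strict_monoI) simp
  ultimately have "(\<lambda>N. \<Sum>p\<in>primes_upto (2 ^ N). real p powr (-1 - \<sigma>)) \<longlonglongrightarrow> prime_zeta \<sigma>"
    by (rule filterlim_compose)
  then have b_sums: "b sums prime_zeta \<sigma>"
    unfolding sums_def b_def B_def sum_dyadic_primes .
  show summable: "summable (\<lambda>n. dyadic_prime_sum n * x ^ n)"
  proof (rule summable_comparison_test')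
    show "summable (\<lambda>n. b n / x)" using b_sums by (intro summable_divide) (rule sums_summable)
    show "norm (dyadic_prime_sum n * x ^ n) \<le> b n / x" for n
      using lb[of n] x nonneg[of n] by (simp add: field_simps)
  qed
  show "prime_zeta \<sigma> \<le> (\<Sum>n. dyadic_prime_sum n * x ^ n)"
    by (rule sums_le[OF ub b_sums summable_sums[OF summable]])
  have "(\<lambda>n. dyadic_prime_sum n * x ^ Suc n) sums (x * (\<Sum>n. dyadic_prime_sum n * x ^ n))"
    using sums_mult[OF summable_sums[OF summable], of x] by (simp add: mult_ac)
  from sums_le[OF lb this b_sums]
  show "x * (\<Sum>n. dyadic_prime_sum n * x ^ n) \<le> prime_zeta \<sigma>" .
qed

text \<open>The logarithmic series with its index shifted, so that 1 / (n + 1) is the coefficient of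
  x^n, matching the n-th dyadic block.\<close>

lemma harmonic_powser:
  fixes x :: real
  assumes "0 < x" "x < 1"
  shows "summable (\<lambda>n. 1 / real (Suc n) * x ^ n)"
    and "x * (\<Sum>n. 1 / real (Suc n) * x ^ n) = - ln (1 - x)"
proof -
  show summable: "summable (\<lambda>n. 1 / real (Suc n) * x ^ n)"
  proof (rule summable_comparison_test')
    show "summable (\<lambda>n. x ^ n)" using assms by (intro summable_geometric) auto
    show "norm (1 / real (Suc n) * x ^ n) \<le> x ^ n" for n
      using assms by (simp add: divide_le_eq mult_le_cancel_left1 del: of_nat_Suc)
  qed
  have "ln (1 - x) = (\<Sum>n. (- 1) ^ n * (1 / real (n + 1)) * (1 - x - 1) ^ Suc n)"
    using assms by (intro ln_series) auto
  also have "(\<lambda>n. (- 1) ^ n * (1 / real (n + 1)) * (1 - x - 1) ^ Suc n) =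
      (\<lambda>n. - (x * (1 / real (Suc n) * x ^ n)))"
  proof
    fix n
    have "(1 - x - 1) ^ Suc n = (-1) ^ Suc n * x ^ Suc n"
      by (simp flip: power_mult_distrib)
    then show "(- 1) ^ n * (1 / real (n + 1)) * (1 - x - 1) ^ Suc n = - (x * (1 / real (Suc n) * x ^ n))"
      by (simp add: power_mult_distrib [symmetric] mult.assoc [symmetric])
  qed
  also have "suminf \<dots> = - (x * (\<Sum>n. 1 / real (Suc n) * x ^ n))"
    by (intro sums_unique [symmetric] sums_minus sums_mult summable_sums summable)
  finally show "x * (\<Sum>n. 1 / real (Suc n) * x ^ n) = - ln (1 - x)" by simp
qed

section \<open>The value of the constant and Mertens' third theorem\<close>

lemma mertens_constant:
  assumes M: "(\<lambda>n. prime_reciprocal_sum n - ln (ln (real n))) \<longlonglongrightarrow> M"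
  shows "M = euler_mascheroni - suminf (log_euler_remainder 0)"
proof -
  define K where "K = suminf (log_euler_remainder 0)"
  define c where "c n = dyadic_prime_sum n - 1 / real (Suc n)" for n
  define x where "x \<sigma> = 2 powr (-\<sigma>)" for \<sigma> :: real
  define \<zeta> where "\<zeta> \<sigma> = (\<Sum>n. real (Suc n) powr (-1 - \<sigma>))" for \<sigma> :: real
  \<comment> \<open>The summand \<open>ln (ln 2)\<close> comes from ln (ln (2^N)) = ln N + ln (ln
    2). The ln N cancels against that of the harmonic number, which leaves the Euler-Mascheroni
    constant.\<close>
  define L where "L = M + ln (ln 2) - euler_mascheroni"
  have c_partial: "(\<Sum>n<N. c n) = prime_reciprocal_sum (2 ^ N) - harm N" for N
  proof -
    have "(\<Sum>n<N. 1 / real (Suc n)) = harm N"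
      by (induction N) (simp_all add: harm_Suc harm_def inverse_eq_divide)
    then show ?thesis
      by (simp add: c_def sum_subtractf dyadic_prime_sum_def sum_dyadic_primes prime_reciprocal_sum_def
          del: of_nat_Suc power_Suc)
  qed
  have "filterlim (\<lambda>N::nat. 2 ^ N :: nat) at_top sequentially"
    by (intro filterlim_subseq strict_monoI) simp
  from filterlim_compose[OF M this]
  have "(\<lambda>N. prime_reciprocal_sum (2 ^ N) - ln (ln (real (2 ^ N))) + ln (ln 2) - (harm N - ln (real N))) \<longlonglongrightarrow> L"
    unfolding L_def by (intro tendsto_intros euler_mascheroni_LIMSEQ)
  moreover have "\<forall>\<^sub>F N in sequentially.
      prime_reciprocal_sum (2 ^ N) - ln (ln (real (2 ^ N))) + ln (ln 2) - (harm N - ln (real N)) = (\<Sum>n<N. c n)"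
    using eventually_gt_at_top[of 0]
  proof eventually_elim
    case (elim N)
    then have "ln (ln (real (2 ^ N))) = ln (real N) + ln (ln 2)"
      by (simp add: ln_realpow ln_mult)
    then show ?case by (simp add: c_partial)
  qed
  ultimately have "c sums L" unfolding sums_def by (rule Lim_transform_eventually)
  then have "((\<lambda>y. \<Sum>n. c n * y ^ n) \<longlongrightarrow> L) (at_left 1)" by (rule abel_limit)
  moreover have x_lim: "filterlim x (at_left 1) (at_right 0)"
    unfolding x_def by real_asymp
  ultimately have "((\<lambda>\<sigma>. \<Sum>n. c n * x \<sigma> ^ n) \<longlongrightarrow> L) (at_right 0)"
    by (rule filterlim_compose)
  moreover have x_lim': "(x \<longlongrightarrow> 1) (at_right 0)"
    unfolding x_def by real_asymp
  \<comment> \<open>The factor x tends to 1 and turns the harmonic part of the series into exactly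
    \<open>- ln (1 - x)\<close>.\<close>
  ultimately have "((\<lambda>\<sigma>. x \<sigma> * (\<Sum>n. c n * x \<sigma> ^ n)) \<longlongrightarrow> 1 * L) (at_right 0)"
    by (intro tendsto_mult)
  then have lim_L: "((\<lambda>\<sigma>. x \<sigma> * (\<Sum>n. c n * x \<sigma> ^ n)) \<longlongrightarrow> L) (at_right 0)" by simp
  have pos: "\<forall>\<^sub>F \<sigma> in at_right (0::real). \<sigma> > 0" by (rule eventually_at_right_less)
  have x_bounds: "0 < x \<sigma>" "x \<sigma> < 1" if "\<sigma> > 0" for \<sigma>
    using that by (simp_all add: x_def powr_less_one)
  \<comment> \<open>Separately ln \<zeta> and ln (1 - x) diverge. Moving a factor \<sigma> from one
    to the other gives \<sigma> \<zeta> \<rightarrow> 1 and (1 - x) / \<sigma> \<rightarrow> ln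
    2.\<close>
  have "((\<lambda>\<sigma>. \<sigma> * \<zeta> \<sigma>) \<longlongrightarrow> 1) (at_right 0)"
  proof (rule tendsto_sandwich)
    show "\<forall>\<^sub>F \<sigma> in at_right 0. 1 \<le> \<sigma> * \<zeta> \<sigma>" "\<forall>\<^sub>F \<sigma> in at_right 0. \<sigma> * \<zeta> \<sigma> \<le> 1 + \<sigma>"
      using pos by (eventually_elim, use zeta_bounds in \<open>simp add: \<zeta>_def field_simps\<close>)+
    show "((\<lambda>\<sigma>. 1 + \<sigma>) \<longlongrightarrow> 1) (at_right (0::real))" by real_asymp
  qed simp
  then have "((\<lambda>\<sigma>. ln (\<sigma> * \<zeta> \<sigma>)) \<longlongrightarrow> ln 1) (at_right 0)" by (rule tendsto_ln) simp
  moreover have "((\<lambda>\<sigma>. ln ((1 - x \<sigma>) / \<sigma>)) \<longlongrightarrow> ln (ln 2)) (at_right 0)"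
    unfolding x_def by real_asymp
  ultimately have "((\<lambda>\<sigma>. ln (\<sigma> * \<zeta> \<sigma>) + ln ((1 - x \<sigma>) / \<sigma>) - suminf (log_euler_remainder \<sigma>))
      \<longlongrightarrow> ln 1 + ln (ln 2) - K) (at_right 0)"
    unfolding K_def by (intro tendsto_add tendsto_diff log_euler_remainder_tendsto)
  moreover have "\<forall>\<^sub>F \<sigma> in at_right 0. ln (\<sigma> * \<zeta> \<sigma>) + ln ((1 - x \<sigma>) / \<sigma>) - suminf (log_euler_remainder \<sigma>)
      = prime_zeta \<sigma> + ln (1 - x \<sigma>)"
    using pos
  proof eventually_elim
    case (elim \<sigma>)
    have "0 < 1 / \<sigma>" using elim by simp
    then have "\<zeta> \<sigma> > 0" using zeta_bounds(1)[OF elim] unfolding \<zeta>_def by linarith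
    then show ?case
      using elim x_bounds[OF elim] ln_zeta_eq[OF elim] by (simp add: \<zeta>_def ln_mult ln_div)
  qed
  ultimately have lim_upper: "((\<lambda>\<sigma>. prime_zeta \<sigma> + ln (1 - x \<sigma>)) \<longlongrightarrow> ln (ln 2) - K) (at_right 0)"
    by (simp add: tendsto_cong)
  \<comment> \<open>The expression equals (1 - x) * \<open>prime_zeta\<close>. That it tends to 0
    shows that weighting \<open>prime_zeta\<close> by x leaves the limit unchanged, so both bounds
    of the sandwich agree.\<close>
  have "((\<lambda>\<sigma>. (1 - x \<sigma>) * (prime_zeta \<sigma> + ln (1 - x \<sigma>)) - (1 - x \<sigma>) * ln (1 - x \<sigma>))
      \<longlongrightarrow> (1 - 1) * (ln (ln 2) - K) - 0) (at_right 0)"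
  proof (intro tendsto_diff tendsto_mult lim_upper tendsto_const x_lim')
    show "((\<lambda>\<sigma>. (1 - x \<sigma>) * ln (1 - x \<sigma>)) \<longlongrightarrow> 0) (at_right 0)"
      unfolding x_def by real_asymp
  qed
  from tendsto_diff[OF lim_upper this]
  have lim_lower: "((\<lambda>\<sigma>. x \<sigma> * prime_zeta \<sigma> + ln (1 - x \<sigma>)) \<longlongrightarrow> ln (ln 2) - K) (at_right 0)"
    by (simp add: algebra_simps)
  have sandwich: "x \<sigma> * prime_zeta \<sigma> + ln (1 - x \<sigma>) \<le> x \<sigma> * (\<Sum>n. c n * x \<sigma> ^ n) \<and>
      x \<sigma> * (\<Sum>n. c n * x \<sigma> ^ n) \<le> prime_zeta \<sigma> + ln (1 - x \<sigma>)" if \<sigma>: "\<sigma> > 0" for \<sigma>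
  proof -
    note x = x_bounds[OF \<sigma>]
    note G = dyadic_prime_sum_powser_bounds[OF \<sigma>, folded x_def]
    note H = harmonic_powser[OF x]
    have "(\<Sum>n. c n * x \<sigma> ^ n) = (\<Sum>n. dyadic_prime_sum n * x \<sigma> ^ n) - (\<Sum>n. 1 / real (Suc n) * x \<sigma> ^ n)"
      unfolding c_def left_diff_distrib by (rule suminf_diff [symmetric]) (rule G H)+
    then have "x \<sigma> * (\<Sum>n. c n * x \<sigma> ^ n) = x \<sigma> * (\<Sum>n. dyadic_prime_sum n * x \<sigma> ^ n) + ln (1 - x \<sigma>)"
      using H(2) by (simp add: right_diff_distrib)
    moreover have "x \<sigma> * prime_zeta \<sigma> \<le> x \<sigma> * (\<Sum>n. dyadic_prime_sum n * x \<sigma> ^ n)"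
      using G(2) x by (intro mult_left_mono) auto
    ultimately show ?thesis using G(3) by simp
  qed
  have "((\<lambda>\<sigma>. x \<sigma> * (\<Sum>n. c n * x \<sigma> ^ n)) \<longlongrightarrow> ln (ln 2) - K) (at_right 0)"
    by (rule tendsto_sandwich[OF _ _ lim_lower lim_upper]; use pos sandwich in \<open>auto elim!: eventually_mono\<close>)
  with lim_L have "L = ln (ln 2) - K" by (intro tendsto_unique[OF _ lim_L]) auto
  then show ?thesis by (simp add: L_def K_def)
qed

text \<open>Exponentiate ln (1 - 1/p) = -1/p - remainder, summed over primes. The sum of the
  remainders cancels the one inside M and leaves the Euler-Mascheroni constant.\<close>

lemma mertens_third:
  "(\<lambda>N. (\<Prod>p\<in>primes_upto N. 1 - 1 / real p) * ln (real N)) \<longlonglongrightarrow> exp (- euler_mascheroni)"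
proof -
  obtain M where M: "(\<lambda>n. prime_reciprocal_sum n - ln (ln (real n))) \<longlonglongrightarrow> M"
    using mertens_second by blast
  have "(\<lambda>N. exp (- (prime_reciprocal_sum N - ln (ln (real N))) - (\<Sum>n\<le>N. log_euler_remainder 0 n)))
      \<longlonglongrightarrow> exp (- M - suminf (log_euler_remainder 0))"
    by (intro tendsto_intros M summable_LIMSEQ' summable_log_euler_remainder) simp
  moreover have "\<forall>\<^sub>F N in sequentially.
      exp (- (prime_reciprocal_sum N - ln (ln (real N))) - (\<Sum>n\<le>N. log_euler_remainder 0 n)) =
      (\<Prod>p\<in>primes_upto N. 1 - 1 / real p) * ln (real N)"
    using eventually_gt_at_top[of 1]
  proof eventually_elim
    case (elim N)
    have rem: "log_euler_remainder 0 n = (if prime n then - ln (1 - 1 / real n) - 1 / real n else 0)" for n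
      by (simp add: log_euler_remainder_def powr_minus_divide prime_gt_0_nat)
    have "- (prime_reciprocal_sum N - ln (ln (real N))) - (\<Sum>n\<le>N. log_euler_remainder 0 n) =
        (\<Sum>p\<in>primes_upto N. ln (1 - 1 / real p)) + ln (ln (real N))"
      unfolding rem sum_primes_upto [symmetric] prime_reciprocal_sum_def
      by (simp add: sum_subtractf sum_negf)
    then have "exp (- (prime_reciprocal_sum N - ln (ln (real N))) - (\<Sum>n\<le>N. log_euler_remainder 0 n)) =
        (\<Prod>p\<in>primes_upto N. exp (ln (1 - 1 / real p))) * ln (real N)"
      using elim by (simp only: exp_add exp_sum finite_primes_upto) simp
    also have "(\<Prod>p\<in>primes_upto N. exp (ln (1 - 1 / real p))) = (\<Prod>p\<in>primes_upto N. 1 - 1 / real p)"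
      by (intro prod.cong refl) (auto simp: primes_upto_def field_simps dest: prime_gt_1_nat)
    finally show ?case .
  qed
  ultimately have "(\<lambda>N. (\<Prod>p\<in>primes_upto N. 1 - 1 / real p) * ln (real N))
      \<longlonglongrightarrow> exp (- M - suminf (log_euler_remainder 0))"
    by (rule Lim_transform_eventually)
  then show ?thesis by (simp add: mertens_constant[OF M])
qed

section \<open>The limit along the primorials\<close>

text \<open>Enumeration is increasing and starts at index 0, so the first k + 1 primes are those up
  to entry k. This makes the primorials a subsequence of the products over primes up to N.\<close>

lemma primorial_Suc_eq: "primorial (Suc k) = \<Prod>(primes_upto (enumerate {p. prime p} k))"
proof -
  let ?e = "enumerate {p :: nat. prime p}"
  have inf: "infinite {p :: nat. prime p}" by (rule primes_infinite)
  have "?e ` {..<Suc k} = primes_upto (?e k)"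
  proof (intro equalityI subsetI)
    fix p assume "p \<in> ?e ` {..<Suc k}"
    then obtain i where i: "p = ?e i" "i \<le> k" by (auto simp: less_Suc_eq_le)
    then show "p \<in> primes_upto (?e k)"
      using enumerate_in_set[OF inf, of i] inf by (simp add: primes_upto_def)
  next
    fix p assume p: "p \<in> primes_upto (?e k)"
    then obtain i where i: "p = ?e i"
      using enumerate_Ex[of "{p. prime p}" p] inf by (auto simp: primes_upto_def)
    with p have "i \<le> k" using inf by (simp add: primes_upto_def)
    then show "p \<in> ?e ` {..<Suc k}" using i by auto
  qed
  moreover have "inj_on ?e {..<Suc k}"
    using inj_enumerate[OF inf] by (rule inj_on_subset) simp
  ultimately show ?thesis
    unfolding primorial_def using prod.reindex[of ?e "{..<Suc k}" "\<lambda>p. p"] by simp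
qed

section \<open>The twin prime product and the final limit\<close>

abbreviation twin_prime_factor :: "nat \<Rightarrow> real" where
  "twin_prime_factor p \<equiv> if prime p \<and> p > 2 then real p * (real p - 2) / (real p - 1)\<^sup>2 else 1"

text \<open>A nontrivial factor differs from 1 by 1 / (p - 1)^2 \<le> 4 / p^2, so the product
  converges absolutely.\<close>

lemma twin_prime_product_tendsto:
  "(\<lambda>N. \<Prod>p\<le>N. twin_prime_factor p) \<longlonglongrightarrow> twin_prime_constant"
proof -
  have "summable (\<lambda>p. norm (twin_prime_factor p - 1))"
  proof (rule summable_comparison_test')
    show "summable (\<lambda>p. 4 * real p powr (-2))" by (intro summable_mult) (simp add: summable_real_powr_iff)
    fix p :: nat
    show "norm (norm (twin_prime_factor p - 1)) \<le> 4 * real p powr (-2)"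
    proof (cases "prime p \<and> p > 2")
      case True
      then have p: "real p > 2" by simp
      have "real p * (real p - 2) / (real p - 1)\<^sup>2 - 1 = - (1 / (real p - 1)\<^sup>2)"
        using p by (simp add: divide_simps) (simp add: power2_eq_square algebra_simps)
      then have "norm (norm (twin_prime_factor p - 1)) = 1 / (real p - 1)\<^sup>2" using True by simp
      also have "\<dots> \<le> 1 / (real p / 2)\<^sup>2"
        using p by (intro divide_left_mono power_mono) auto
      also have "\<dots> = 4 * real p powr (-2)"
        using p by (simp add: powr_minus_divide power_divide)
      finally show ?thesis .
    qed auto
  qed
  then have "convergent_prod twin_prime_factor"
    by (intro abs_convergent_prod_imp_convergent_prod) (simp only: abs_convergent_prod_conv_summable)
  then show ?thesis unfolding twin_prime_constant_def by (rule convergent_prod_LIMSEQ)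
qed

lemma primitive_proportion_twice_primes_upto:
  assumes "N \<ge> 2"
  shows "primitive_proportion (2 * \<Prod>(primes_upto N)) =
    (\<Prod>p\<le>N. twin_prime_factor p) * (\<Prod>p\<in>primes_upto N. 1 - 1 / real p)"
proof -
  define S where "S = primes_upto N - {2}"
  have S: "prime p \<and> p > 2" if "p \<in> S" for p
    using that prime_ge_2_nat[of p] by (auto simp: S_def primes_upto_def)
  have two: "2 \<in> primes_upto N" using assms by (simp add: primes_upto_def)
  have "\<Prod>(primes_upto N) = 2 * \<Prod>S"
    unfolding S_def using two by (intro prod.remove) auto
  then have "primitive_proportion (2 * \<Prod>(primes_upto N)) = 1 / 2 * (\<Prod>p\<in>S. (real p - 2) / (real p - 1))"
    using primitive_proportion_4_times_odd_primes[of S] S by (simp add: S_def)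
  also have "(\<Prod>p\<in>S. (real p - 2) / (real p - 1)) =
      (\<Prod>p\<in>S. real p * (real p - 2) / (real p - 1)\<^sup>2 * (1 - 1 / real p))"
  proof (rule prod.cong[OF refl])
    fix p assume "p \<in> S"
    then have "real p > 2" using S by simp
    then show "(real p - 2) / (real p - 1) = real p * (real p - 2) / (real p - 1)\<^sup>2 * (1 - 1 / real p)"
      by (simp add: divide_simps power2_eq_square)
  qed
  also have "\<dots> = (\<Prod>p\<in>S. real p * (real p - 2) / (real p - 1)\<^sup>2) * (\<Prod>p\<in>S. 1 - 1 / real p)"
    by (rule prod.distrib)
  also have "(\<Prod>p\<in>S. real p * (real p - 2) / (real p - 1)\<^sup>2) = (\<Prod>p\<le>N. twin_prime_factor p)"
    using S by (intro prod.mono_neutral_cong_left) (auto simp: S_def primes_upto_def)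
  \<comment> \<open>The value 1/2 at modulus 4 is read as the missing Mertens factor at p = 2, while
    the twin prime factor at 2 is 1.\<close>
  also have "1 / 2 * ((\<Prod>p\<le>N. twin_prime_factor p) * (\<Prod>p\<in>S. 1 - 1 / real p)) =
      (\<Prod>p\<le>N. twin_prime_factor p) * ((1 - 1 / real 2) * (\<Prod>p\<in>S. 1 - 1 / real p))"
    by simp
  also have "(1 - 1 / real 2) * (\<Prod>p\<in>S. 1 - 1 / real p) = (\<Prod>p\<in>primes_upto N. 1 - 1 / real p)"
    unfolding S_def using two by (intro prod.remove [symmetric]) auto
  finally show ?thesis .
qed

theorem mainTheorem4:
  shows "(\<lambda>k. primitive_proportion (2 * primorial k) * ln (ln (real (2 * primorial k))))
           \<longlonglongrightarrow> twin_prime_constant * exp (- euler_mascheroni)"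
proof -
  \<comment> \<open>The limit is first taken over all N and then restricted to the values of N that
    are primes.\<close>
  define h where "h N = primitive_proportion (2 * \<Prod>(primes_upto N)) *
    ln (ln (real (2 * \<Prod>(primes_upto N))))" for N
  \<comment> \<open>The inserted ln N, which cancels, gives the last two factors finite
    limits.\<close>
  have "(\<lambda>N. (\<Prod>p\<le>N. twin_prime_factor p) * ((\<Prod>p\<in>primes_upto N. 1 - 1 / real p) * ln (real N)) *
      (ln (chebyshev_theta N + ln 2) / ln (real N))) \<longlonglongrightarrow> twin_prime_constant * exp (- euler_mascheroni) * 1"
    by (intro tendsto_mult twin_prime_product_tendsto mertens_third ln_chebyshev_theta_asymp)
  moreover have "\<forall>\<^sub>F N in sequentially.
      (\<Prod>p\<le>N. twin_prime_factor p) * ((\<Prod>p\<in>primes_upto N. 1 - 1 / real p) * ln (real N)) *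
      (ln (chebyshev_theta N + ln 2) / ln (real N)) = h N"
    using eventually_ge_at_top[of 2]
  proof eventually_elim
    case (elim N)
    have "\<Prod>(primes_upto N) > 0" by (intro prod_pos) (auto simp: primes_upto_def prime_gt_0_nat)
    then have "real (\<Prod>(primes_upto N)) > 0" by (simp only: of_nat_0_less_iff)
    then have "ln (real (2 * \<Prod>(primes_upto N))) = chebyshev_theta N + ln 2"
      using ln_mult_pos[of 2 "real (\<Prod>(primes_upto N))"]
      by (simp add: chebyshev_theta_eq_ln_prod del: of_nat_prod)
    moreover have "ln (real N) > 0" using elim by simp
    ultimately show ?case
      unfolding h_def primitive_proportion_twice_primes_upto[OF elim] by simp
  qed
  ultimately have "h \<longlonglongrightarrow> twin_prime_constant * exp (- euler_mascheroni)"
    by (simp add: Lim_transform_eventually)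
  moreover have "filterlim (enumerate {p :: nat. prime p}) at_top sequentially"
    by (intro filterlim_subseq strict_monoI enumerate_mono primes_infinite)
  ultimately have "(\<lambda>k. h (enumerate {p. prime p} k)) \<longlonglongrightarrow> twin_prime_constant * exp (- euler_mascheroni)"
    by (rule filterlim_compose)
  then have "(\<lambda>k. primitive_proportion (2 * primorial (Suc k)) * ln (ln (real (2 * primorial (Suc k)))))
      \<longlonglongrightarrow> twin_prime_constant * exp (- euler_mascheroni)"
    by (simp only: h_def primorial_Suc_eq)
  \<comment> \<open>The empty primorial at k = 0 is not of the form used above; dropping one term
    does not change the limit.\<close>
  then show ?thesis by (rule LIMSEQ_imp_Suc)
qed

end
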